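(* Let $t\in\{0,1,2,\dots\}$ and $\xi(t)\in\mathcal{X}$ be given, and suppose that $f$ and $h$ obey Gaussian processes as described in the context, independent of $(t,\xi(t))$. For the given $(t,\xi(t))$ and a given dataset $\mathcal{D}$, let $\gamma_{\mathrm{u}*}$ and $\gamma_{\mathrm{l}*}$ be the unique scalars satisfying $$\delta(\gamma_{\mathrm{u}*},\xi(t),\mathcal{D})=\delta_*/2,\qquad \delta(\gamma_{\mathrm{l}*},\xi(t),\mathcal{D})=1-\delta_*/2,$$ and define $$\eta:=-\hat u(t)+\big([r(t+1)]_2-[\xi(t)]_2\big)/\tau,\qquad u_{\mathrm u}:=-\gamma_{\mathrm{u}*}+(\overline r/\tau)+\eta,\qquad u_{\mathrm l}:=-\gamma_{\mathrm{l}*}-(\overline r/\tau)+\eta .$$ Then the chance constraint $$\mathrm{Pr}\Big(\big|[\xi(t+1)]_2-[r(t+1)]_2\big|\le\overline r\;\Big|\;\xi(t),\mathcal{D}\Big)\ge 1-\delta_*$$ is satisfied if $$u(t)=\begin{cases}u_{\mathrm u} & (u_{\mathrm u}<0)\\ u_{\mathrm l} & (u_{\mathrm l}>0)\\ 0 & (\text{otherwise})\end{cases}\qquad\text{and}\qquad u_{\mathrm l}\le u_{\mathrm u}.$$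
   Context: Control system. $[v]_i$ denotes the $i$-th component of a vector $v$. The time step is $\tau>0$; $\overline r\ge 0$ and $\delta_*\in(0,1)$ are given parameters. The reference $r(t)\in\mathbb{R}^2$ satisfies $r(t+1)=r(t)+\tau\,[\,[r(t)]_2,\;v(t)\,]^\top$, where $v(t)\in\mathbb{R}$ is a known signal. The state $\xi(t)\in\mathbb{R}^2$ satisfies $$\xi(t+1)=\xi(t)+\tau\begin{bmatrix}[\xi(t)]_2\\ f(\xi(t))+\hat u(t)+u(t)\end{bmatrix},\qquad \hat u(t)=v(t)-\big([\xi(t)]_1-[r(t)]_1\big)/\tau,$$ where $f$ is an unknown disturbance and $u(t)\in\mathbb{R}$ is the control input to be designed. The value of $\xi(t)$ is treated as a given point of $\mathcal{X}$ not affecting the probabilistic model below. Data model. Let $\mathcal{X}\subseteq\mathbb{R}^2$, and let $f:\mathcal{X}\to\mathbb{R}$ and $g:\mathcal{X}\to(0,\infty)$ be unknown (random) functions; put $h(x):=\ln g(x)^2$. Let $x_1,\dots,x_D\in\mathcal{X}$ be $D$ given (deterministic) pairwise distinct training inputs. For each $d\in\{1,\dots,D\}$ one observes $S\ge 1$ outputs $y_{d,s}=f(x_d)+w_{d,s}$, $s\in\{1,\dots,S\}$, where $w_{d,s}\mid g(x_d)\sim\mathcal{N}(0,g(x_d)^2)$; the normalized noises $w_{d,s}/g(x_d)$ are i.i.d. $\mathcal{N}(0,1)$ over all $(d,s)$ and independent of $(f,h)$. Gaussian process assumption. $f$ and $h$ are independent zero-mean Gaussian processes with strictly positive definite kernels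 $k:\mathcal{X}\times\mathcal{X}\to\mathbb{R}$ and $\ell:\mathcal{X}\times\mathcal{X}\to\mathbb{R}$, respectively: for any natural number $N$ and any distinct points $x_1',\dots,x_N'\in\mathcal{X}$, the Gram matrices $(k(x_i',x_j'))_{i,j}$ and $(\ell(x_i',x_j'))_{i,j}$ are positive definite; given any $h$, $[f(x_1'),\dots,f(x_N')]^\top\sim\mathcal{N}(0,(k(x_i',x_j'))_{i,j})$; and given any $f$, $[h(x_1'),\dots,h(x_N')]^\top\sim\mathcal{N}(0,(\ell(x_i',x_j'))_{i,j})$. Notation. $k_D(x):=[k(x,x_1),\dots,k(x,x_D)]^\top\in\mathbb{R}^D$; $K_D:=(k(x_i,x_j))_{i,j=1}^D$; $y^{\mathrm E}_d:=\frac1S\sum_{s=1}^S y_{d,s}$; $y^{\mathrm E}_{1:D}:=[y^{\mathrm E}_1,\dots,y^{\mathrm E}_D]^\top$; $h_d:=h(x_d)$; $h_{1:D}:=[h_1,\dots,h_D]^\top$; $\widetilde K(h_{1:D}):=K_D+\frac1S\,\mathrm{diag}(\exp h_1,\dots,\exp h_D)$. The dataset is $\mathcal{D}:=[x_{1:D},y^{\mathrm E}_{1:D}]$; since the inputs are deterministic, conditioning on $\mathcal{D}$ means conditioning on $y^{\mathrm E}_{1:D}$. The complementary error function is $\mathrm{erfc}(a):=\frac{2}{\sqrt\pi}\int_a^\infty \exp(-t^2)\,dt$, and for $\gamma\in\mathbb{R}$, $x\in\mathcal{X}$, $$\delta(\gamma,x,\mathcal{D}) := \frac12\,\mathbb{E}\left[\mathrm{erfc}\left(\frac{\gamma-k_D(x)^\top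 \widetilde K(h_{1:D})^{-1} y^{\mathrm E}_{1:D}}{\sqrt{2}\,\sqrt{k(x,x)-k_D(x)^\top\widetilde K(h_{1:D})^{-1}k_D(x)}}\right)\,\middle|\, x,\mathcal{D}\right],$$ the expectation being with respect to the conditional law of $h_{1:D}$ given $\mathcal{D}$. *)

theory Defs
  imports "HOL-Probability.Probability"
begin

definition erfc :: "real \<Rightarrow> real" where
  "erfc a = 2 / sqrt pi * (LINT t:{a..}|lborel. exp (- (t\<^sup>2)))"


section \<open>Gaussian processes\<close>

text \<open>The number of sample points is quantified inside the definition of a Gaussian process, so
  the \<open>N\<close>-dimensional vectors and matrices occurring there are functions on indices \<open>< N\<close>.\<close>

definition pos_def_matrix :: "nat \<Rightarrow> (nat \<Rightarrow> nat \<Rightarrow> real) \<Rightarrow> bool" where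
  "pos_def_matrix N C \<longleftrightarrow>
     (\<forall>i<N. \<forall>j<N. C i j = C j i) \<and>
     (\<forall>z :: nat \<Rightarrow> real. (\<exists>i<N. z i \<noteq> 0) \<longrightarrow> 0 < (\<Sum>i<N. \<Sum>j<N. z i * C i j * z j))"

definition strictly_pos_def_kernel :: "'a set \<Rightarrow> ('a \<Rightarrow> 'a \<Rightarrow> real) \<Rightarrow> bool" where
  "strictly_pos_def_kernel X k \<longleftrightarrow>
     (\<forall>N p. inj_on p {..<N} \<and> p ` {..<N} \<subseteq> X \<longrightarrow> pos_def_matrix N (\<lambda>i j. k (p i) (p j)))"

text \<open>\<open>\<nu> = N(0, C)\<close>: the law of \<open>A Z\<close>, where \<open>Z\<close> has independent standard normal components and
  \<open>A A\<^sup>T = C\<close>. The law does not depend on the choice of \<open>A\<close>.\<close>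

definition centered_normal_law :: "nat \<Rightarrow> (nat \<Rightarrow> nat \<Rightarrow> real) \<Rightarrow> (nat \<Rightarrow> real) measure \<Rightarrow> bool" where
  "centered_normal_law N C \<nu> \<longleftrightarrow>
     (\<exists>A :: nat \<Rightarrow> nat \<Rightarrow> real.
        (\<forall>i<N. \<forall>j<N. (\<Sum>m<N. A i m * A j m) = C i j) \<and>
        \<nu> = distr (\<Pi>\<^sub>M i\<in>{..<N}. density lborel std_normal_density) (\<Pi>\<^sub>M i\<in>{..<N}. borel)
               (\<lambda>z. \<lambda>i\<in>{..<N}. \<Sum>m<N. A i m * z m))"

definition gaussian_process ::
  "'w measure \<Rightarrow> 'a set \<Rightarrow> ('w \<Rightarrow> 'a \<Rightarrow> real) \<Rightarrow> ('a \<Rightarrow> 'a \<Rightarrow> real) \<Rightarrow> bool" where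
  "gaussian_process M X F k \<longleftrightarrow>
     (\<forall>p\<in>X. (\<lambda>\<omega>. F \<omega> p) \<in> borel_measurable M) \<and>
     (\<forall>N p. inj_on p {..<N} \<and> p ` {..<N} \<subseteq> X \<longrightarrow>
        centered_normal_law N (\<lambda>i j. k (p i) (p j))
          (distr M (\<Pi>\<^sub>M i\<in>{..<N}. borel) (\<lambda>\<omega>. \<lambda>i\<in>{..<N}. F \<omega> (p i))))"


section \<open>Independence and conditioning\<close>

text \<open>Unlike \<open>prob_space.indep_var\<close>, this allows the two random elements to have different types.\<close>

definition indep_elements ::
  "'w measure \<Rightarrow> 'b measure \<Rightarrow> ('w \<Rightarrow> 'b) \<Rightarrow> 'c measure \<Rightarrow> ('w \<Rightarrow> 'c) \<Rightarrow> bool" where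
  "indep_elements M N1 Y N2 Z \<longleftrightarrow>
     Y \<in> M \<rightarrow>\<^sub>M N1 \<and> Z \<in> M \<rightarrow>\<^sub>M N2 \<and>
     prob_space.indep_set M {Y -` A \<inter> space M |A. A \<in> sets N1} {Z -` B \<inter> space M |B. B \<in> sets N2}"

definition cond_prob_given ::
  "'w measure \<Rightarrow> ('w \<Rightarrow> 'b::topological_space) \<Rightarrow> 'w set \<Rightarrow> 'w \<Rightarrow> real" where
  "cond_prob_given M Y E = real_cond_exp M (vimage_algebra (space M) Y borel) (indicator E)"

text \<open>\<open>\<kappa>\<close> is a (version of the) regular conditional law of \<open>Z\<close> given \<open>Y\<close>.\<close>

definition is_cond_law ::
  "'w measure \<Rightarrow> ('w \<Rightarrow> 'b::topological_space) \<Rightarrow> ('w \<Rightarrow> 'c::topological_space) \<Rightarrow>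
   ('b \<Rightarrow> 'c measure) \<Rightarrow> bool" where
  "is_cond_law M Y Z \<kappa> \<longleftrightarrow>
     \<kappa> \<in> borel \<rightarrow>\<^sub>M prob_algebra borel \<and>
     (\<forall>B\<in>sets borel. AE \<omega> in M.
        cond_prob_given M Y (Z -` B \<inter> space M) \<omega> = measure (\<kappa> (Y \<omega>)) B)"


section \<open>Regression with heteroscedastic noise\<close>

definition kernel_vec :: "('a \<Rightarrow> 'a \<Rightarrow> real) \<Rightarrow> ('n::finite \<Rightarrow> 'a) \<Rightarrow> 'a \<Rightarrow> real ^ 'n" where
  "kernel_vec k x p = (\<chi> d. k p (x d))"

definition gram_matrix :: "('a \<Rightarrow> 'a \<Rightarrow> real) \<Rightarrow> ('n::finite \<Rightarrow> 'a) \<Rightarrow> real ^ 'n ^ 'n" where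
  "gram_matrix k x = (\<chi> i j. k (x i) (x j))"

definition noisy_gram ::
  "('a \<Rightarrow> 'a \<Rightarrow> real) \<Rightarrow> ('n::finite \<Rightarrow> 'a) \<Rightarrow> nat \<Rightarrow> real ^ 'n \<Rightarrow> real ^ 'n ^ 'n" where
  "noisy_gram k x S h =
     gram_matrix k x + (1 / real S) *\<^sub>R (\<chi> i j. if i = j then exp (h $ i) else 0)"

text \<open>\<open>y\<close> is the vector of averaged outputs, and \<open>\<kappa> y\<close> the conditional law of the log-variances
  at the training inputs given \<open>y\<close>.\<close>

definition tail_delta ::
  "('a \<Rightarrow> 'a \<Rightarrow> real) \<Rightarrow> ('n::finite \<Rightarrow> 'a) \<Rightarrow> nat \<Rightarrow> (real ^ 'n \<Rightarrow> (real ^ 'n) measure) \<Rightarrow>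
   real \<Rightarrow> 'a \<Rightarrow> real ^ 'n \<Rightarrow> real" where
  "tail_delta k x S \<kappa> \<gamma> p y =
     1 / 2 * (\<integral>h. erfc
       ((\<gamma> - kernel_vec k x p \<bullet> (matrix_inv (noisy_gram k x S h) *v y)) /
        (sqrt 2 * sqrt (k p p -
           kernel_vec k x p \<bullet> (matrix_inv (noisy_gram k x S h) *v kernel_vec k x p)))) \<partial>(\<kappa> y))"

end

theory Submission
  imports Defs
begin

text \<open>Given the log-variances \<open>h\<close> at the training inputs and the averaged outputs \<open>y\<close>, the
  value \<open>f \<xi>\<close> is normal with the usual regression mean and variance. Averaging over the conditional
  law of the log-variances, the conditional probability of \<open>f \<xi> \<ge> \<gamma>\<close> given \<open>y\<close> is
  \<open>tail_delta \<dots> \<gamma> \<xi> y\<close>, and this remains true when \<open>\<gamma>\<close> is a measurable function of \<open>y\<close>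
  (\<open>cond_prob_tail\<close>). With the two cutoffs of the control law the event \<open>\<gamma>l \<le> f \<xi> < \<gamma>u\<close> therefore has
  conditional probability at least \<open>(1 - \<delta>s / 2) - \<delta>s / 2\<close>. The tracking error is
  \<open>\<tau> (f \<xi> + u - \<eta>)\<close>, and \<open>ul \<le> u \<le> uu\<close> whenever \<open>ul \<le> uu\<close>, so on that event its absolute
  value is at most \<open>rbar\<close>.

  The cutoffs exist, are unique and depend measurably on \<open>y\<close> because \<open>tail_delta\<close> is the tail
  function of a mixture of normal laws with positive variances, which has no atoms and charges every
  interval. The variances are positive, even at a training input, because of the noise.

  The conditional law of \<open>f \<xi>\<close> is obtained without multivariate densities. The definition of a
  Gaussian process writes the values at \<open>\<xi>\<close> and at the training inputs as linear forms in a standard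
  normal vector. Appending the normalised noises to that vector, \<open>f \<xi>\<close> and the averaged outputs are
  linear forms in one standard normal vector \<open>z\<close>, whose coefficients depend on the frozen value of
  \<open>h\<close>. The coefficient vector of the regression residual is orthogonal to those of the outputs. Since
  the law of \<open>z\<close> does not change when its component along a unit vector is replaced by a fresh
  standard normal variable (\<open>resample_std_normal_component\<close>), the residual can be resampled without
  changing the outputs (\<open>gaussian_regression\<close>).\<close>

section \<open>Resampling one component of a standard normal vector\<close>

abbreviation std_normal :: "real measure" where
  "std_normal \<equiv> density lborel std_normal_density"

interpretation std_normal: prob_space std_normal
  by (rule prob_space_normal_density) simp

lemma product_sigma_finite_lborel: "product_sigma_finite (\<lambda>_::'i. lborel :: real measure)"
  by unfold_locales

lemma PiM_lborel_shift:
  fixes c :: "'i \<Rightarrow> real"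
  assumes I: "finite I"
  shows "distr (\<Pi>\<^sub>M i\<in>I. lborel) (\<Pi>\<^sub>M i\<in>I. lborel) (\<lambda>z. \<lambda>i\<in>I. z i + c i) = (\<Pi>\<^sub>M i\<in>I. lborel)"
proof -
  interpret product_sigma_finite "\<lambda>_::'i. lborel :: real measure"
    by (rule product_sigma_finite_lborel)
  show ?thesis
  proof (rule PiM_eqI[OF I])
    fix A :: "'i \<Rightarrow> real set"
    assume A: "\<And>i. i \<in> I \<Longrightarrow> A i \<in> sets lborel"
    let ?f = "\<lambda>z. \<lambda>i\<in>I. z i + c i"
    have B: "(+) (c i) -` A i \<in> sets lborel" if "i \<in> I" for i
      using measurable_sets[OF _ A[OF that, simplified], of "(+) (c i)" borel] by simp
    have "?f -` Pi\<^sub>E I A \<inter> space (\<Pi>\<^sub>M i\<in>I. lborel) = (\<Pi>\<^sub>E i\<in>I. (+) (c i) -` A i)"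
      by (auto simp: space_PiM PiE_iff add.commute)
    moreover have "Pi\<^sub>E I A \<in> sets (\<Pi>\<^sub>M i\<in>I. lborel)"
      using I A by (intro sets_PiM_I_finite) auto
    moreover have "?f \<in> (\<Pi>\<^sub>M i\<in>I. lborel) \<rightarrow>\<^sub>M (\<Pi>\<^sub>M i\<in>I. lborel)"
      by measurable
    ultimately have "emeasure (distr (\<Pi>\<^sub>M i\<in>I. lborel) (\<Pi>\<^sub>M i\<in>I. lborel) ?f) (Pi\<^sub>E I A)
        = (\<Prod>i\<in>I. emeasure lborel ((+) (c i) -` A i))"
      using emeasure_PiM[OF I B] by (simp add: emeasure_distr)
    also have "\<dots> = (\<Prod>i\<in>I. emeasure lborel (A i))"
    proof (rule prod.cong[OF refl])
      fix i assume i: "i \<in> I"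
      have "emeasure lborel (A i) = emeasure (distr lborel borel ((+) (c i))) (A i)"
        by (simp only: lborel_distr_plus)
      also have "\<dots> = emeasure lborel ((+) (c i) -` A i)"
        using A[OF i] by (simp add: emeasure_distr)
      finally show "emeasure lborel ((+) (c i) -` A i) = emeasure lborel (A i)" by simp
    qed
    finally show "emeasure (distr (\<Pi>\<^sub>M i\<in>I. lborel) (\<Pi>\<^sub>M i\<in>I. lborel) ?f) (Pi\<^sub>E I A)
        = (\<Prod>i\<in>I. emeasure lborel (A i))" .
  qed simp
qed

text \<open>Expresses the standard normal law relative to Lebesgue measure, under which shears are measure
  preserving.\<close>

lemma PiM_std_normal_density:
  assumes I: "finite (I :: 'i set)"
  shows "(\<Pi>\<^sub>M i\<in>I. std_normal) =
    density (\<Pi>\<^sub>M i\<in>I. lborel) (\<lambda>z. \<Prod>i\<in>I. ennreal (std_normal_density (z i)))"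
proof -
  interpret L: product_sigma_finite "\<lambda>_::'i. lborel :: real measure"
    by (rule product_sigma_finite_lborel)
  interpret N: product_sigma_finite "\<lambda>_::'i. std_normal"
    by unfold_locales
  show ?thesis
  proof (rule N.PiM_eqI[OF I, symmetric])
    show "sets (density (\<Pi>\<^sub>M i\<in>I. lborel) (\<lambda>z. \<Prod>i\<in>I. ennreal (std_normal_density (z i))))
        = sets (\<Pi>\<^sub>M i\<in>I. std_normal)"
      unfolding sets_density by (rule sets_PiM_cong) auto
  next
    fix A :: "'i \<Rightarrow> real set"
    assume A: "\<And>i. i \<in> I \<Longrightarrow> A i \<in> sets std_normal"
    have PA: "Pi\<^sub>E I A \<in> sets (\<Pi>\<^sub>M i\<in>I. lborel)"
      using I A by (intro sets_PiM_I_finite) auto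
    have "emeasure (density (\<Pi>\<^sub>M i\<in>I. lborel) (\<lambda>z. \<Prod>i\<in>I. ennreal (std_normal_density (z i)))) (Pi\<^sub>E I A)
       = (\<integral>\<^sup>+z. (\<Prod>i\<in>I. ennreal (std_normal_density (z i))) * indicator (Pi\<^sub>E I A) z \<partial>(\<Pi>\<^sub>M i\<in>I. lborel))"
      using PA by (subst emeasure_density) auto
    also have "\<dots> = (\<integral>\<^sup>+z. (\<Prod>i\<in>I. ennreal (std_normal_density (z i)) * indicator (A i) (z i))
        \<partial>(\<Pi>\<^sub>M i\<in>I. lborel))"
    proof (rule nn_integral_cong)
      fix z assume "z \<in> space (\<Pi>\<^sub>M i\<in>I. (lborel :: real measure))"
      then have "indicator (Pi\<^sub>E I A) z = (\<Prod>i\<in>I. indicator (A i) (z i) :: ennreal)"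
        using I by (auto simp: indicator_def space_PiM PiE_iff split: if_splits)
      then show "(\<Prod>i\<in>I. ennreal (std_normal_density (z i))) * indicator (Pi\<^sub>E I A) z
          = (\<Prod>i\<in>I. ennreal (std_normal_density (z i)) * indicator (A i) (z i))"
        by (simp add: prod.distrib)
    qed
    also have "\<dots> = (\<Prod>i\<in>I. \<integral>\<^sup>+t. ennreal (std_normal_density t) * indicator (A i) t \<partial>lborel)"
      using A by (intro L.product_nn_integral_prod[OF I]) auto
    also have "\<dots> = (\<Prod>i\<in>I. emeasure std_normal (A i))"
      using A by (intro prod.cong) (auto simp: emeasure_density)
    finally show "emeasure (density (\<Pi>\<^sub>M i\<in>I. lborel) (\<lambda>z. \<Prod>i\<in>I. ennreal (std_normal_density (z i)))) (Pi\<^sub>E I A)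
       = (\<Prod>i\<in>I. emeasure std_normal (A i))" .
  qed
qed

text \<open>A shear preserves Lebesgue measure because it is a translation once the sheared-along variable
  is fixed: here \<open>t\<close>, in the next lemma \<open>z\<close>.\<close>

lemma nn_integral_shear_vector:
  fixes a :: "'i \<Rightarrow> real"
  assumes I: "finite I"
    and K: "(\<lambda>(z, t). K z t) \<in> borel_measurable ((\<Pi>\<^sub>M i\<in>I. lborel) \<Otimes>\<^sub>M lborel)"
  shows "(\<integral>\<^sup>+z. \<integral>\<^sup>+t. K (\<lambda>i\<in>I. z i + t * a i) t \<partial>lborel \<partial>(\<Pi>\<^sub>M i\<in>I. lborel))
       = (\<integral>\<^sup>+z. \<integral>\<^sup>+t. K z t \<partial>lborel \<partial>(\<Pi>\<^sub>M i\<in>I. lborel))"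
proof -
  interpret product_sigma_finite "\<lambda>_::'i. lborel :: real measure"
    by (rule product_sigma_finite_lborel)
  interpret finite_product_sigma_finite "\<lambda>_::'i. lborel :: real measure" I
    by standard fact
  interpret P: pair_sigma_finite "\<Pi>\<^sub>M i\<in>I. (lborel :: real measure)" "lborel :: real measure"
    by unfold_locales
  note K[measurable]
  have "(\<integral>\<^sup>+z. \<integral>\<^sup>+t. K (\<lambda>i\<in>I. z i + t * a i) t \<partial>lborel \<partial>(\<Pi>\<^sub>M i\<in>I. lborel))
      = (\<integral>\<^sup>+t. \<integral>\<^sup>+z. K (\<lambda>i\<in>I. z i + t * a i) t \<partial>(\<Pi>\<^sub>M i\<in>I. lborel) \<partial>lborel)"
    by (rule P.Fubini'[symmetric]) measurable
  also have "\<dots> = (\<integral>\<^sup>+t. \<integral>\<^sup>+z. K z t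
      \<partial>(distr (\<Pi>\<^sub>M i\<in>I. lborel) (\<Pi>\<^sub>M i\<in>I. lborel) (\<lambda>z. \<lambda>i\<in>I. z i + t * a i)) \<partial>lborel)"
    by (intro nn_integral_cong nn_integral_distr[symmetric]) measurable
  also have "\<dots> = (\<integral>\<^sup>+t. \<integral>\<^sup>+z. K z t \<partial>(\<Pi>\<^sub>M i\<in>I. lborel) \<partial>lborel)"
    by (simp only: PiM_lborel_shift[OF I])
  also have "\<dots> = (\<integral>\<^sup>+z. \<integral>\<^sup>+t. K z t \<partial>lborel \<partial>(\<Pi>\<^sub>M i\<in>I. lborel))"
    by (rule P.Fubini') measurable
  finally show ?thesis .
qed

lemma nn_integral_shear_scalar:
  fixes c :: "('i \<Rightarrow> real) \<Rightarrow> real"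
  assumes I: "finite I"
    and K: "(\<lambda>(z, t). K z t) \<in> borel_measurable ((\<Pi>\<^sub>M i\<in>I. lborel) \<Otimes>\<^sub>M lborel)"
  shows "(\<integral>\<^sup>+z. \<integral>\<^sup>+t. K z (t - c z) \<partial>lborel \<partial>(\<Pi>\<^sub>M i\<in>I. lborel))
       = (\<integral>\<^sup>+z. \<integral>\<^sup>+t. K z t \<partial>lborel \<partial>(\<Pi>\<^sub>M i\<in>I. lborel))"
proof (rule nn_integral_cong)
  fix z :: "'i \<Rightarrow> real" assume z[measurable]: "z \<in> space (\<Pi>\<^sub>M i\<in>I. lborel)"
  note K[measurable]
  have "(\<integral>\<^sup>+t. K z t \<partial>lborel) = (\<integral>\<^sup>+t. K z t \<partial>(distr lborel borel ((+) (- c z))))"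
    by (simp only: lborel_distr_plus)
  also have "\<dots> = (\<integral>\<^sup>+t. K z (t - c z) \<partial>lborel)"
    by (subst nn_integral_distr) simp_all
  finally show "(\<integral>\<^sup>+t. K z (t - c z) \<partial>lborel) = (\<integral>\<^sup>+t. K z t \<partial>lborel)" by simp
qed

text \<open>Adjoin an independent standard normal variable \<open>t\<close> to \<open>z\<close>. In the plane spanned by the direction
  \<open>a\<close> and the \<open>t\<close>-axis, a quarter turn exchanges \<open>t\<close> with the component \<open>p\<close> of \<open>z\<close> along \<open>a\<close>. It
  preserves the Euclidean norm, hence the Gaussian weight, and it is a product of three shears, hence
  preserves Lebesgue measure. So \<open>z\<close> with its component \<open>p\<close> replaced by \<open>t\<close> has the same law as \<open>z\<close>.\<close>

lemma resample_std_normal_component: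
  fixes a :: "'i \<Rightarrow> real"
  assumes I: "finite I"
    and a: "(\<Sum>i\<in>I. a i * a i) = 1"
    and H: "H \<in> borel_measurable (\<Pi>\<^sub>M i\<in>I. std_normal)"
  shows "(\<integral>\<^sup>+z. H z \<partial>(\<Pi>\<^sub>M i\<in>I. std_normal)) =
    (\<integral>\<^sup>+z. \<integral>\<^sup>+t. H (\<lambda>i\<in>I. z i + (t - (\<Sum>j\<in>I. a j * z j)) * a i) \<partial>std_normal \<partial>(\<Pi>\<^sub>M i\<in>I. std_normal))"
proof -
  interpret product_sigma_finite "\<lambda>_::'i. lborel :: real measure"
    by (rule product_sigma_finite_lborel)
  have H'[measurable]: "H \<in> borel_measurable (\<Pi>\<^sub>M i\<in>I. lborel)"
    using H by (simp cong: measurable_cong_sets sets_PiM_cong)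
  let ?L = "\<Pi>\<^sub>M i\<in>I. (lborel :: real measure)"
  define p where "p z = (\<Sum>j\<in>I. a j * z j)" for z :: "'i \<Rightarrow> real"
  define w where "w z = (\<Prod>i\<in>I. ennreal (std_normal_density (z i)))" for z :: "'i \<Rightarrow> real"
  define W where "W z t = w z * ennreal (std_normal_density t)" for z t
  define z' where "z' z t = (\<lambda>i\<in>I. z i + (t - p z) * a i)" for z t
  define K where "K z t = H z * W z t" for z t
  have p[measurable]: "p \<in> borel_measurable ?L"
    unfolding p_def by measurable
  have w[measurable]: "w \<in> borel_measurable ?L"
    unfolding w_def by measurable
  have z'[measurable]: "(\<lambda>(z, t). z' z t) \<in> ?L \<Otimes>\<^sub>M lborel \<rightarrow>\<^sub>M ?L"
    unfolding z'_def by measurable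
  have K[measurable]: "(\<lambda>(z, t). K z t) \<in> borel_measurable (?L \<Otimes>\<^sub>M lborel)"
    unfolding K_def W_def by measurable
  have p_line: "p (\<lambda>i\<in>I. z i + t * a i) = p z + t" for z t
  proof -
    have "p (\<lambda>i\<in>I. z i + t * a i) = (\<Sum>j\<in>I. a j * z j) + t * (\<Sum>j\<in>I. a j * a j)"
      by (simp add: p_def algebra_simps sum.distrib sum_distrib_left)
    then show ?thesis by (simp add: a p_def)
  qed
  have p_mult: "(\<Sum>i\<in>I. z i * a i) = p z" for z
    by (simp add: p_def mult.commute)
  have W_invariant: "W (z' z t) (- p z) = W z t" for z t
  proof -
    have W_eq: "W z t = ennreal ((1 / sqrt (2 * pi)) ^ Suc (card I) *
        exp (- ((\<Sum>i\<in>I. (z i)\<^sup>2) + t\<^sup>2) / 2))" for z t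
    proof -
      have "W z t = ennreal ((\<Prod>i\<in>I. 1 / sqrt (2 * pi) * exp (- (z i)\<^sup>2 / 2)) *
          (1 / sqrt (2 * pi) * exp (- t\<^sup>2 / 2)))"
        unfolding W_def w_def std_normal_density_def
        by (subst prod_ennreal) (auto simp: prod_nonneg simp flip: ennreal_mult)
      also have "(\<Prod>i\<in>I. 1 / sqrt (2 * pi) * exp (- (z i)\<^sup>2 / 2))
          = (1 / sqrt (2 * pi)) ^ card I * exp (\<Sum>i\<in>I. - (z i)\<^sup>2 / 2)"
        by (simp only: prod.distrib prod_constant exp_sum[OF I])
      also have "(\<Sum>i\<in>I. - (z i)\<^sup>2 / 2) = - (\<Sum>i\<in>I. (z i)\<^sup>2) / 2"
        by (simp add: sum_divide_distrib sum_negf)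
      finally show ?thesis
        by (simp add: field_simps flip: exp_add)
    qed
    have "(\<Sum>i\<in>I. (z' z t i)\<^sup>2) =
       (\<Sum>i\<in>I. (z i)\<^sup>2 + 2 * (t - p z) * (z i * a i) + (t - p z)\<^sup>2 * (a i * a i))"
      by (intro sum.cong) (auto simp: z'_def power2_eq_square algebra_simps)
    also have "\<dots> = (\<Sum>i\<in>I. (z i)\<^sup>2) + 2 * (t - p z) * p z + (t - p z)\<^sup>2"
      by (simp add: sum.distrib a p_mult flip: sum_distrib_left)
    finally have "(\<Sum>i\<in>I. (z' z t i)\<^sup>2) + (- p z)\<^sup>2 = (\<Sum>i\<in>I. (z i)\<^sup>2) + t\<^sup>2"
      by (simp add: power2_eq_square algebra_simps)
    then show ?thesis unfolding W_eq by simp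
  qed
  have std: "(\<integral>\<^sup>+t. G t \<partial>std_normal) = (\<integral>\<^sup>+t. ennreal (std_normal_density t) * G t \<partial>lborel)"
    if "G \<in> borel_measurable borel" for G
    using that by (simp add: nn_integral_density)
  have PiM: "(\<integral>\<^sup>+z. G z \<partial>(\<Pi>\<^sub>M i\<in>I. std_normal)) = (\<integral>\<^sup>+z. w z * G z \<partial>?L)"
    if "G \<in> borel_measurable ?L" for G
    using that unfolding PiM_std_normal_density[OF I] w_def by (simp add: nn_integral_density)
  have "(\<integral>\<^sup>+z. H z \<partial>(\<Pi>\<^sub>M i\<in>I. std_normal)) = (\<integral>\<^sup>+z. w z * H z \<partial>?L)"
    by (rule PiM) measurable
  also have "\<dots> = (\<integral>\<^sup>+z. \<integral>\<^sup>+t. K z t \<partial>lborel \<partial>?L)"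
  proof (rule nn_integral_cong)
    fix z
    have "(\<integral>\<^sup>+t. K z t \<partial>lborel) = (\<integral>\<^sup>+t. w z * H z * ennreal (std_normal_density t) \<partial>lborel)"
      by (simp add: K_def W_def ac_simps)
    also have "\<dots> = w z * H z * (\<integral>\<^sup>+t. ennreal (std_normal_density t) \<partial>lborel)"
      by (subst nn_integral_cmult) simp_all
    also have "(\<integral>\<^sup>+t. ennreal (std_normal_density t) \<partial>lborel) = 1"
      using std_normal.emeasure_space_1 by (simp add: emeasure_density)
    finally show "w z * H z = (\<integral>\<^sup>+t. K z t \<partial>lborel)" by simp
  qed
  \<comment> \<open>The three shears act on the plane by
    (p, t) \<mapsto> (p + t, t) \<mapsto> (p + t, - p) \<mapsto> (t, - p).\<close>
  also have "\<dots> = (\<integral>\<^sup>+z. \<integral>\<^sup>+t. K (\<lambda>i\<in>I. z i + t * a i) t \<partial>lborel \<partial>?L)"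
    by (rule nn_integral_shear_vector[OF I K, symmetric])
  also have "\<dots> = (\<integral>\<^sup>+z. \<integral>\<^sup>+t. K (\<lambda>i\<in>I. z i + (t - p z) * a i) (t - p z) \<partial>lborel \<partial>?L)"
    by (rule nn_integral_shear_scalar[OF I, symmetric]) measurable
  also have "\<dots> = (\<integral>\<^sup>+z. \<integral>\<^sup>+t. K (z' (\<lambda>i\<in>I. z i + t * a i) t) (t - p (\<lambda>i\<in>I. z i + t * a i)) \<partial>lborel \<partial>?L)"
    unfolding z'_def[symmetric]
    by (rule nn_integral_shear_vector[OF I, symmetric]) measurable
  also have "\<dots> = (\<integral>\<^sup>+z. \<integral>\<^sup>+t. K (z' z t) (- p z) \<partial>lborel \<partial>?L)"
  proof (intro nn_integral_cong)
    fix z t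
    have "z' (\<lambda>i\<in>I. z i + t * a i) t = z' z t"
      unfolding z'_def p_line by (intro restrict_ext) (auto simp: algebra_simps)
    then show "K (z' (\<lambda>i\<in>I. z i + t * a i) t) (t - p (\<lambda>i\<in>I. z i + t * a i)) = K (z' z t) (- p z)"
      by (simp add: p_line)
  qed
  also have "\<dots> = (\<integral>\<^sup>+z. w z * (\<integral>\<^sup>+t. H (z' z t) \<partial>std_normal) \<partial>?L)"
  proof (rule nn_integral_cong)
    fix z assume [measurable]: "z \<in> space ?L"
    have "(\<integral>\<^sup>+t. K (z' z t) (- p z) \<partial>lborel)
        = (\<integral>\<^sup>+t. w z * (ennreal (std_normal_density t) * H (z' z t)) \<partial>lborel)"
      by (simp only: K_def W_invariant) (simp add: W_def ac_simps)
    also have "\<dots> = w z * (\<integral>\<^sup>+t. H (z' z t) \<partial>std_normal)"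
      by (subst nn_integral_cmult) (simp_all add: std)
    finally show "(\<integral>\<^sup>+t. K (z' z t) (- p z) \<partial>lborel) = w z * (\<integral>\<^sup>+t. H (z' z t) \<partial>std_normal)" .
  qed
  also have "\<dots> = (\<integral>\<^sup>+z. \<integral>\<^sup>+t. H (z' z t) \<partial>std_normal \<partial>(\<Pi>\<^sub>M i\<in>I. std_normal))"
    by (rule PiM[symmetric]) measurable
  finally show ?thesis by (simp only: z'_def p_def)
qed

section \<open>Independence and conditional laws\<close>

lemma vimage_sets_compose:
  assumes Y: "Y \<in> M \<rightarrow>\<^sub>M N" and f: "f \<in> N \<rightarrow>\<^sub>M L"
  shows "{(\<lambda>\<omega>. f (Y \<omega>)) -` A \<inter> space M |A. A \<in> sets L} \<subseteq> {Y -` A \<inter> space M |A. A \<in> sets N}"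
proof clarify
  fix A assume "A \<in> sets L"
  moreover have "(\<lambda>\<omega>. f (Y \<omega>)) -` A \<inter> space M = Y -` (f -` A \<inter> space N) \<inter> space M"
    using measurable_space[OF Y] by auto
  ultimately show "\<exists>B. (\<lambda>\<omega>. f (Y \<omega>)) -` A \<inter> space M = Y -` B \<inter> space M \<and> B \<in> sets N"
    using measurable_sets[OF f] by metis
qed

lemma indep_elements_compose:
  assumes M: "prob_space M" and indep: "indep_elements M N1 Y N2 Z"
    and f: "f \<in> N1 \<rightarrow>\<^sub>M L1" and g: "g \<in> N2 \<rightarrow>\<^sub>M L2"
  shows "indep_elements M L1 (\<lambda>\<omega>. f (Y \<omega>)) L2 (\<lambda>\<omega>. g (Z \<omega>))"
proof -
  interpret prob_space M by fact
  have Y: "Y \<in> M \<rightarrow>\<^sub>M N1" and Z: "Z \<in> M \<rightarrow>\<^sub>M N2"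
    and set: "indep_set {Y -` A \<inter> space M |A. A \<in> sets N1} {Z -` B \<inter> space M |B. B \<in> sets N2}"
    using indep by (simp_all add: indep_elements_def)
  show ?thesis
    unfolding indep_elements_def
  proof (intro conjI)
    show "(\<lambda>\<omega>. f (Y \<omega>)) \<in> M \<rightarrow>\<^sub>M L1" "(\<lambda>\<omega>. g (Z \<omega>)) \<in> M \<rightarrow>\<^sub>M L2"
      using Y Z f g by (auto intro: measurable_compose)
    show "indep_set {(\<lambda>\<omega>. f (Y \<omega>)) -` A \<inter> space M |A. A \<in> sets L1}
        {(\<lambda>\<omega>. g (Z \<omega>)) -` B \<inter> space M |B. B \<in> sets L2}"
      unfolding indep_set_def
    proof (rule indep_sets_mono_sets[OF set[unfolded indep_set_def]])
      fix i :: bool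
      show "(case i of True \<Rightarrow> {(\<lambda>\<omega>. f (Y \<omega>)) -` A \<inter> space M |A. A \<in> sets L1}
            | False \<Rightarrow> {(\<lambda>\<omega>. g (Z \<omega>)) -` B \<inter> space M |B. B \<in> sets L2})
          \<subseteq> (case i of True \<Rightarrow> {Y -` A \<inter> space M |A. A \<in> sets N1}
            | False \<Rightarrow> {Z -` B \<inter> space M |B. B \<in> sets N2})"
        using vimage_sets_compose[OF Y f] vimage_sets_compose[OF Z g] by (cases i) simp_all
    qed
  qed
qed

lemma indep_elements_of_indep_var:
  assumes "prob_space M" and "prob_space.indep_var M N1 Y N2 Z"
  shows "indep_elements M N1 Y N2 Z"
proof -
  interpret prob_space M by fact
  show ?thesis
    using assms(2) unfolding indep_var_eq indep_elements_def indep_sets2_eq by blast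
qed

lemma distr_pair_indep_elements:
  assumes M: "prob_space M" and indep: "indep_elements M N1 Y N2 Z"
  shows "distr M (N1 \<Otimes>\<^sub>M N2) (\<lambda>\<omega>. (Y \<omega>, Z \<omega>)) = distr M N1 Y \<Otimes>\<^sub>M distr M N2 Z"
proof -
  interpret prob_space M by fact
  have Y[measurable]: "Y \<in> M \<rightarrow>\<^sub>M N1" and Z[measurable]: "Z \<in> M \<rightarrow>\<^sub>M N2"
    using indep by (simp_all add: indep_elements_def)
  interpret Y: prob_space "distr M N1 Y" by (rule prob_space_distr) measurable
  interpret Z: prob_space "distr M N2 Z" by (rule prob_space_distr) measurable
  show ?thesis
  proof (rule pair_measure_eqI[symmetric])
    fix A B assume "A \<in> sets (distr M N1 Y)" and "B \<in> sets (distr M N2 Z)"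
    then have A[measurable]: "A \<in> sets N1" and B[measurable]: "B \<in> sets N2" by simp_all
    have "prob ((Y -` A \<inter> space M) \<inter> (Z -` B \<inter> space M)) =
        prob (Y -` A \<inter> space M) * prob (Z -` B \<inter> space M)"
      using indep A B by (intro indep_setD) (auto simp: indep_elements_def)
    moreover have "(\<lambda>\<omega>. (Y \<omega>, Z \<omega>)) -` (A \<times> B) \<inter> space M = (Y -` A \<inter> space M) \<inter> (Z -` B \<inter> space M)"
      by auto
    ultimately show "emeasure (distr M N1 Y) A * emeasure (distr M N2 Z) B =
        emeasure (distr M (N1 \<Otimes>\<^sub>M N2) (\<lambda>\<omega>. (Y \<omega>, Z \<omega>))) (A \<times> B)"
      by (simp add: emeasure_distr emeasure_eq_measure ennreal_mult)
  qed (simp_all add: Y.sigma_finite_measure_axioms Z.sigma_finite_measure_axioms)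
qed

lemma finite_measure_subalgebra_vimage:
  fixes Y :: "'w \<Rightarrow> 'b::topological_space"
  assumes "prob_space M" and "Y \<in> borel_measurable M"
  shows "finite_measure_subalgebra M (vimage_algebra (space M) Y borel)"
proof -
  interpret prob_space M by fact
  show ?thesis
  proof unfold_locales
    show "subalgebra M (vimage_algebra (space M) Y borel)"
      unfolding subalgebra_def using sets_image_in_sets[OF refl assms(2)] by simp
  qed
qed

text \<open>Both sides integrate \<open>G\<close> against probability measures on the product space, which agree on
  rectangles by the defining property of the conditional expectation of \<open>indicator B \<circ> Z\<close>.\<close>

lemma nn_integral_cond_law:
  fixes Y :: "'w \<Rightarrow> 'b::topological_space" and Z :: "'w \<Rightarrow> 'c::topological_space"
  assumes M: "prob_space M" and \<kappa>: "is_cond_law M Y Z \<kappa>"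
    and Y[measurable]: "Y \<in> borel_measurable M" and Z[measurable]: "Z \<in> borel_measurable M"
    and G: "G \<in> borel_measurable (borel \<Otimes>\<^sub>M borel)"
  shows "(\<integral>\<^sup>+\<omega>. G (Y \<omega>, Z \<omega>) \<partial>M) = (\<integral>\<^sup>+\<omega>. \<integral>\<^sup>+z. G (Y \<omega>, z) \<partial>\<kappa> (Y \<omega>) \<partial>M)"
proof -
  interpret prob_space M by fact
  interpret C: finite_measure_subalgebra M "vimage_algebra (space M) Y borel"
    by (rule finite_measure_subalgebra_vimage[OF M Y])
  have \<kappa>_prob: "\<kappa> \<in> borel \<rightarrow>\<^sub>M prob_algebra borel"
    using \<kappa> by (simp add: is_cond_law_def)
  have \<kappa>_sub[measurable]: "(\<lambda>\<omega>. \<kappa> (Y \<omega>)) \<in> M \<rightarrow>\<^sub>M subprob_algebra borel"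
    using measurable_compose[OF Y measurable_prob_algebraD[OF \<kappa>_prob]] .
  have \<kappa>_space: "\<kappa> y \<in> space (prob_algebra borel)" for y
    using measurable_space[OF \<kappa>_prob] by simp
  have sets_\<kappa>[simp, measurable_cong]: "sets (\<kappa> y) = sets borel" for y
    using \<kappa>_space[of y] by (simp add: space_prob_algebra)
  \<comment> \<open>K \<omega> is the candidate for the conditional law of the pair (Y, Z), concentrated on Y = Y \<omega>.\<close>
  define K where "K \<omega> = distr (\<kappa> (Y \<omega>)) (borel \<Otimes>\<^sub>M borel) (Pair (Y \<omega>))" for \<omega>
  have K: "K \<in> M \<rightarrow>\<^sub>M subprob_algebra (borel \<Otimes>\<^sub>M borel)"
    unfolding K_def by (rule measurable_distr2[OF _ \<kappa>_sub]) measurable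
  have emeasure_K: "emeasure (K \<omega>) (A \<times> B) = indicator A (Y \<omega>) * emeasure (\<kappa> (Y \<omega>)) B"
    if "A \<in> sets borel" "B \<in> sets borel" for \<omega> A B
  proof -
    have "Pair (Y \<omega>) -` (A \<times> B) \<inter> space (\<kappa> (Y \<omega>)) = (if Y \<omega> \<in> A then B else {})"
      using sets_eq_imp_space_eq[OF sets_\<kappa>, of "Y \<omega>"] by auto
    moreover have "Pair (Y \<omega>) \<in> \<kappa> (Y \<omega>) \<rightarrow>\<^sub>M borel \<Otimes>\<^sub>M borel"
    proof -
      have "Pair (Y \<omega>) \<in> (borel :: 'c measure) \<rightarrow>\<^sub>M borel \<Otimes>\<^sub>M borel"
        by (rule measurable_Pair1') simp
      then show ?thesis
        by (simp only: measurable_cong_sets[OF sets_\<kappa> refl])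
    qed
    ultimately show ?thesis
      using that unfolding K_def by (simp add: emeasure_distr)
  qed
  interpret L: prob_space "distr M (borel \<Otimes>\<^sub>M borel) (\<lambda>\<omega>. (Y \<omega>, Z \<omega>))"
    by (rule prob_space_distr) measurable
  have law: "distr M (borel \<Otimes>\<^sub>M borel) (\<lambda>\<omega>. (Y \<omega>, Z \<omega>)) = M \<bind> K"
  proof (rule measure_eqI_generator_eq[OF Int_stable_pair_measure_generator[of borel borel],
        where \<Omega> = UNIV and A = "\<lambda>_. UNIV"])
    fix U :: "('b \<times> 'c) set" assume "U \<in> {a \<times> b | a b. a \<in> sets borel \<and> b \<in> sets borel}"
    then obtain A B where U: "U = A \<times> B" and A[measurable]: "A \<in> sets borel" and B[measurable]: "B \<in> sets borel"
      by blast
    have YA: "Y -` A \<inter> space M \<in> sets (vimage_algebra (space M) Y borel)"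
      by (rule in_vimage_algebra) measurable
    have ZB: "Z -` B \<inter> space M \<in> sets M" by measurable
    have "emeasure (distr M (borel \<Otimes>\<^sub>M borel) (\<lambda>\<omega>. (Y \<omega>, Z \<omega>))) U
        = prob ((Y -` A \<inter> space M) \<inter> (Z -` B \<inter> space M))"
      by (auto simp: U emeasure_distr emeasure_eq_measure intro!: arg_cong[where f = prob])
    also have "\<dots> = (\<integral>\<omega>\<in>Y -` A \<inter> space M. indicator (Z -` B \<inter> space M) \<omega> \<partial>M)"
      unfolding set_lebesgue_integral_def
      by (simp add: indicator_inter_arith[symmetric] Int_absorb2 Int_commute
          flip: indicator_inter_arith)
    also have "(\<integral>\<omega>\<in>Y -` A \<inter> space M. indicator (Z -` B \<inter> space M) \<omega> \<partial>M)
        = (\<integral>\<omega>\<in>Y -` A \<inter> space M. cond_prob_given M Y (Z -` B \<inter> space M) \<omega> \<partial>M)"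
      unfolding cond_prob_given_def
      by (rule C.real_cond_exp_intA[OF integrable_real_indicator YA]) (simp_all add: ZB emeasure_eq_measure)
    also have "\<dots> = (\<integral>\<omega>. indicator A (Y \<omega>) * measure (\<kappa> (Y \<omega>)) B \<partial>M)"
      unfolding set_lebesgue_integral_def
    proof (rule integral_cong_AE)
      show "AE \<omega> in M. indicator (Y -` A \<inter> space M) \<omega> *\<^sub>R cond_prob_given M Y (Z -` B \<inter> space M) \<omega>
          = indicator A (Y \<omega>) * measure (\<kappa> (Y \<omega>)) B"
        using \<kappa> B unfolding is_cond_law_def by (auto simp: indicator_def)
    qed (use A B in \<open>auto simp: cond_prob_given_def\<close>)
    finally have "emeasure (distr M (borel \<Otimes>\<^sub>M borel) (\<lambda>\<omega>. (Y \<omega>, Z \<omega>))) U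
        = ennreal (\<integral>\<omega>. indicator A (Y \<omega>) * measure (\<kappa> (Y \<omega>)) B \<partial>M)"
      by simp
    also have "\<dots> = (\<integral>\<^sup>+\<omega>. ennreal (indicator A (Y \<omega>) * measure (\<kappa> (Y \<omega>)) B) \<partial>M)"
    proof (rule nn_integral_eq_integral[symmetric])
      show "integrable M (\<lambda>\<omega>. indicator A (Y \<omega>) * measure (\<kappa> (Y \<omega>)) B)"
        using \<kappa>_space
        by (intro integrable_const_bound[where B = 1])
          (auto simp: indicator_def space_prob_algebra prob_space.prob_le_1)
    qed simp
    also have "\<dots> = (\<integral>\<^sup>+\<omega>. emeasure (K \<omega>) U \<partial>M)"
    proof (rule nn_integral_cong)
      fix \<omega>
      interpret k: prob_space "\<kappa> (Y \<omega>)"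
        using \<kappa>_space by (simp add: space_prob_algebra)
      show "ennreal (indicator A (Y \<omega>) * measure (\<kappa> (Y \<omega>)) B) = emeasure (K \<omega>) U"
        using A B by (simp add: U emeasure_K k.emeasure_eq_measure indicator_def)
    qed
    also have "\<dots> = emeasure (M \<bind> K) U"
      using not_empty by (intro emeasure_bind[symmetric, OF _ K]) (auto simp: U)
    finally show "emeasure (distr M (borel \<Otimes>\<^sub>M borel) (\<lambda>\<omega>. (Y \<omega>, Z \<omega>))) U = emeasure (M \<bind> K) U" .
  next
    have "sets (M \<bind> K) = sets (borel \<Otimes>\<^sub>M borel)"
      using measurable_space[OF K] not_empty by (intro sets_bind) (auto simp: space_subprob_algebra)
    then show "sets (M \<bind> K) = sigma_sets UNIV {a \<times> b | a b. a \<in> sets borel \<and> b \<in> sets borel}"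
      by (simp add: sets_pair_measure)
  qed (auto simp: sets_pair_measure intro!: exI[of _ UNIV])
  have "(\<integral>\<^sup>+\<omega>. G (Y \<omega>, Z \<omega>) \<partial>M) = (\<integral>\<^sup>+p. G p \<partial>distr M (borel \<Otimes>\<^sub>M borel) (\<lambda>\<omega>. (Y \<omega>, Z \<omega>)))"
    using G by (intro nn_integral_distr[symmetric]) simp_all
  also have "\<dots> = (\<integral>\<^sup>+p. G p \<partial>(M \<bind> K))"
    by (simp only: law)
  also have "\<dots> = (\<integral>\<^sup>+\<omega>. \<integral>\<^sup>+p. G p \<partial>K \<omega> \<partial>M)"
    by (rule nn_integral_bind[OF G K])
  also have "\<dots> = (\<integral>\<^sup>+\<omega>. \<integral>\<^sup>+z. G (Y \<omega>, z) \<partial>\<kappa> (Y \<omega>) \<partial>M)"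
    unfolding K_def using G by (intro nn_integral_cong nn_integral_distr) auto
  finally show ?thesis .
qed

text \<open>On the conditioning event \<open>Y \<in> B\<close> the inclusion \<open>V - W \<subseteq> E\<close> gives
  \<open>indicator V - indicator W \<le> indicator E\<close>, and indicators of such events can be pulled out of the
  conditional expectation.\<close>

lemma cond_prob_given_ge_diff:
  fixes Y :: "'w \<Rightarrow> 'b::topological_space"
  assumes M: "prob_space M" and Y: "Y \<in> borel_measurable M" and B: "B \<in> sets borel"
    and E[measurable]: "E \<in> sets M" and V[measurable]: "V \<in> sets M" and W[measurable]: "W \<in> sets M"
    and sub: "\<And>\<omega>. \<omega> \<in> space M \<Longrightarrow> Y \<omega> \<in> B \<Longrightarrow> \<omega> \<in> V \<Longrightarrow> \<omega> \<notin> W \<Longrightarrow> \<omega> \<in> E"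
  shows "AE \<omega> in M. Y \<omega> \<in> B \<longrightarrow>
    cond_prob_given M Y V \<omega> - cond_prob_given M Y W \<omega> \<le> cond_prob_given M Y E \<omega>"
proof -
  interpret prob_space M by fact
  let ?F = "vimage_algebra (space M) Y borel"
  interpret C: finite_measure_subalgebra M ?F
    by (rule finite_measure_subalgebra_vimage[OF M Y])
  let ?i = "indicator :: 'w set \<Rightarrow> 'w \<Rightarrow> real"
  define A where "A = Y -` B \<inter> space M"
  have A_F[measurable]: "A \<in> sets ?F"
    unfolding A_def by (rule in_vimage_algebra[OF B])
  have A_M[measurable]: "A \<in> sets M"
    unfolding A_def using Y B by (rule measurable_sets)
  have int: "integrable M (?i U)" if "U \<in> sets M" for U
    using that by (intro integrable_real_indicator) (simp_all add: emeasure_eq_measure)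
  have int_mult: "integrable M (\<lambda>\<omega>. ?i A \<omega> * f \<omega>)" if "integrable M f" for f
    using integrable_mult_indicator[OF A_M that] by simp
  have "AE \<omega> in M. real_cond_exp M ?F (\<lambda>\<omega>. ?i A \<omega> * (?i V \<omega> - ?i W \<omega>)) \<omega>
      \<le> real_cond_exp M ?F (\<lambda>\<omega>. ?i A \<omega> * ?i E \<omega>) \<omega>"
  proof (rule C.real_cond_exp_mono)
    show "AE \<omega> in M. ?i A \<omega> * (?i V \<omega> - ?i W \<omega>) \<le> ?i A \<omega> * ?i E \<omega>"
      using sub by (intro AE_I2) (auto simp: A_def indicator_def)
  qed (intro int_mult int Bochner_Integration.integrable_diff E V W)+
  moreover have "AE \<omega> in M. real_cond_exp M ?F (\<lambda>\<omega>. ?i A \<omega> * ?i E \<omega>) \<omega> = ?i A \<omega> * real_cond_exp M ?F (?i E) \<omega>"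
    by (rule C.real_cond_exp_mult[OF _ _ int_mult[OF int[OF E]]]) measurable
  moreover have "AE \<omega> in M. real_cond_exp M ?F (\<lambda>\<omega>. ?i A \<omega> * (?i V \<omega> - ?i W \<omega>)) \<omega>
      = ?i A \<omega> * real_cond_exp M ?F (\<lambda>\<omega>. ?i V \<omega> - ?i W \<omega>) \<omega>"
    by (rule C.real_cond_exp_mult[OF _ _ int_mult[OF Bochner_Integration.integrable_diff[OF int[OF V] int[OF W]]]]) measurable
  moreover have "AE \<omega> in M. real_cond_exp M ?F (\<lambda>\<omega>. ?i V \<omega> - ?i W \<omega>) \<omega>
      = real_cond_exp M ?F (?i V) \<omega> - real_cond_exp M ?F (?i W) \<omega>"
    by (rule C.real_cond_exp_diff[OF int[OF V] int[OF W]])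
  ultimately show ?thesis
    unfolding cond_prob_given_def
    using AE_space
  proof eventually_elim
    case (elim \<omega>)
    then show ?case by (auto simp: A_def)
  qed
qed

section \<open>Gaussian regression in feature coordinates\<close>

definition regression_mean ::
  "('a \<Rightarrow> 'a \<Rightarrow> real) \<Rightarrow> ('n::finite \<Rightarrow> 'a) \<Rightarrow> nat \<Rightarrow> 'a \<Rightarrow> real ^ 'n \<Rightarrow> real ^ 'n \<Rightarrow> real" where
  "regression_mean k x S p h y = kernel_vec k x p \<bullet> (matrix_inv (noisy_gram k x S h) *v y)"

definition regression_var ::
  "('a \<Rightarrow> 'a \<Rightarrow> real) \<Rightarrow> ('n::finite \<Rightarrow> 'a) \<Rightarrow> nat \<Rightarrow> 'a \<Rightarrow> real ^ 'n \<Rightarrow> real" where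
  "regression_var k x S p h =
     k p p - kernel_vec k x p \<bullet> (matrix_inv (noisy_gram k x S h) *v kernel_vec k x p)"

lemma noisy_gram_component:
  "noisy_gram k x S h $ d $ e = k (x d) (x e) + (if d = e then exp (h $ d) / real S else 0)"
  by (simp add: noisy_gram_def gram_matrix_def)

lemma matrix_inv_right_inverse:
  assumes "invertible A" shows "A ** matrix_inv A = mat 1"
  using assms unfolding invertible_def matrix_inv_def by (rule someI2_ex) simp

lemma borel_measurable_vec_lambda[measurable (raw)]:
  fixes f :: "'n::finite \<Rightarrow> 'b \<Rightarrow> real"
  assumes "\<And>d. f d \<in> borel_measurable M"
  shows "(\<lambda>z. \<chi> d. f d z) \<in> borel_measurable M"
  using assms by (subst borel_measurable_euclidean_space) (auto simp: Basis_vec_def inner_axis)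

lemma borel_measurable_vec_nth[measurable]: "(\<lambda>v :: real ^ 'n. v $ d) \<in> borel_measurable borel"
  by (intro borel_measurable_continuous_onI continuous_intros)

lemma borel_measurable_det:
  fixes A :: "'b \<Rightarrow> real ^ 'n ^ 'n"
  assumes "\<And>i j. (\<lambda>z. A z $ i $ j) \<in> borel_measurable M"
  shows "(\<lambda>z. det (A z)) \<in> borel_measurable M"
  unfolding det_def
  by (intro borel_measurable_sum borel_measurable_times borel_measurable_const borel_measurable_prod assms)

text \<open>By Cramer's rule the entries of the inverse are quotients of polynomials in the entries of \<open>A\<close>.\<close>

lemma borel_measurable_matrix_inv:
  fixes A :: "'b \<Rightarrow> real ^ 'n ^ 'n"
  assumes A: "\<And>i j. (\<lambda>z. A z $ i $ j) \<in> borel_measurable M"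
    and inv: "\<And>z. invertible (A z)"
  shows "(\<lambda>z. matrix_inv (A z) $ i $ j) \<in> borel_measurable M"
proof -
  have "matrix_inv (A z) $ i $ j =
      det (\<chi> i' j'. if j' = i then axis j 1 $ i' else A z $ i' $ j') / det (A z)" for z
  proof -
    have "det (A z) \<noteq> 0"
      using inv invertible_det_nz by blast
    moreover have "A z *v (matrix_inv (A z) *v axis j 1) = axis j 1"
      by (simp add: matrix_vector_mul_assoc matrix_inv_right_inverse[OF inv])
    ultimately have "matrix_inv (A z) *v axis j 1 =
        (\<chi> i. det (\<chi> i' j'. if j' = i then axis j 1 $ i' else A z $ i' $ j') / det (A z))"
      using cramer by blast
    moreover have "matrix_inv (A z) $ i $ j = (matrix_inv (A z) *v axis j 1) $ i"
      by (simp add: matrix_vector_mul_component inner_axis)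
    ultimately show ?thesis by simp
  qed
  moreover have "(\<lambda>z. det (\<chi> i' j'. if j' = i then axis j 1 $ i' else A z $ i' $ j') / det (A z))
      \<in> borel_measurable M"
    using A by (intro borel_measurable_divide borel_measurable_det) simp_all
  ultimately show ?thesis by simp
qed

text \<open>Only the values of the kernel at the query point \<open>q\<close> and at the training inputs matter. There it
  is the Gram matrix of finitely many feature vectors \<open>\<psi> a\<close>, so that the process is represented by
  \<open>a \<mapsto> (\<Sum>m<N. \<psi> a m * z m)\<close> with \<open>z\<close> standard normal.\<close>

locale feature_regression =
  fixes k :: "'a \<Rightarrow> 'a \<Rightarrow> real" and x :: "'n::finite \<Rightarrow> 'a" and S :: nat and q :: 'a
    and N :: nat and \<psi> :: "'a \<Rightarrow> nat \<Rightarrow> real"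
  assumes kernel_eq: "\<And>a b. a \<in> insert q (range x) \<Longrightarrow> b \<in> insert q (range x) \<Longrightarrow>
      k a b = (\<Sum>m<N. \<psi> a m * \<psi> b m)"
    and kernel_pos: "0 < k q q"
    and S: "1 \<le> S"
begin

text \<open>The coordinates \<open>Inl m\<close> carry the process and \<open>Inr (d, s)\<close> the normalised noise of the
  \<open>s\<close>-th observation at the \<open>d\<close>-th input. The vectors \<open>target\<close> and \<open>data h d\<close> are the coefficients
  of the process value at \<open>q\<close> and of the \<open>d\<close>-th averaged output when the log-variances are \<open>h\<close>; then
  \<open>exp (h $ d / 2)\<close> is the standard deviation of a single observation.\<close>

definition coords :: "(nat + 'n \<times> nat) set" where
  "coords = {..<N} <+> (UNIV \<times> {1..S})"

definition dot :: "(nat + 'n \<times> nat \<Rightarrow> real) \<Rightarrow> (nat + 'n \<times> nat \<Rightarrow> real) \<Rightarrow> real" where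
  "dot a b = (\<Sum>i\<in>coords. a i * b i)"

definition target :: "nat + 'n \<times> nat \<Rightarrow> real" where
  "target = case_sum (\<psi> q) (\<lambda>_. 0)"

definition data :: "real ^ 'n \<Rightarrow> 'n \<Rightarrow> nat + 'n \<times> nat \<Rightarrow> real" where
  "data h d = case_sum (\<psi> (x d)) (\<lambda>(d', s). if d' = d then exp (h $ d / 2) / real S else 0)"

definition weights :: "real ^ 'n \<Rightarrow> real ^ 'n" where
  "weights h = matrix_inv (noisy_gram k x S h) *v kernel_vec k x q"

definition residual :: "real ^ 'n \<Rightarrow> nat + 'n \<times> nat \<Rightarrow> real" where
  "residual h i = target i - (\<Sum>d\<in>UNIV. weights h $ d * data h d i)"

lemma finite_coords: "finite coords"
  by (simp add: coords_def)

lemma sum_coords: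
  "(\<Sum>i\<in>coords. F i) = (\<Sum>m<N. F (Inl m)) + (\<Sum>d\<in>UNIV. \<Sum>s=1..S. F (Inr (d, s)))"
  unfolding coords_def by (subst sum.Plus) (simp_all add: sum.cartesian_product)

lemma dot_commute: "dot a b = dot b a"
  by (simp add: dot_def mult.commute)

lemma dot_linear:
  "dot (\<lambda>i. a i - (\<Sum>d\<in>UNIV. v $ d * B d i)) b = dot a b - (\<Sum>d\<in>UNIV. v $ d * dot (B d) b)"
proof -
  have "(\<Sum>i\<in>coords. (\<Sum>d\<in>UNIV. v $ d * B d i) * b i) = (\<Sum>d\<in>UNIV. v $ d * dot (B d) b)"
    unfolding dot_def sum_distrib_left sum_distrib_right
    by (subst sum.swap) (simp add: mult.assoc)
  then show ?thesis by (simp add: dot_def left_diff_distrib sum_subtractf)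
qed

lemma dot_target_target: "dot target target = k q q"
  unfolding dot_def sum_coords by (simp add: target_def kernel_eq)

lemma dot_target_data: "dot target (data h d) = kernel_vec k x q $ d"
  unfolding dot_def sum_coords by (simp add: target_def data_def kernel_vec_def kernel_eq)

lemma dot_data_data: "dot (data h d) (data h e) = noisy_gram k x S h $ d $ e"
proof -
  have "(\<Sum>d'\<in>UNIV. \<Sum>s=1..S. data h d (Inr (d', s)) * data h e (Inr (d', s)))
      = (\<Sum>d'\<in>UNIV. if d' = d then (if d = e then real S * (exp (h $ d / 2) / real S)\<^sup>2 else 0) else 0)"
    by (intro sum.cong) (auto simp: data_def power2_eq_square)
  also have "\<dots> = (if d = e then real S * (exp (h $ d / 2) / real S)\<^sup>2 else 0)"
    by simp
  also have "real S * (exp (h $ d / 2) / real S)\<^sup>2 = exp (h $ d) / real S"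
    using S by (simp add: power2_eq_square field_simps flip: exp_add)
  finally show ?thesis
    unfolding dot_def sum_coords noisy_gram_component by (simp add: kernel_eq data_def)
qed

lemma noisy_gram_commute: "noisy_gram k x S h $ d $ e = noisy_gram k x S h $ e $ d"
  by (metis dot_commute dot_data_data)

lemma dot_self_eq_0_iff: "dot a a = 0 \<longleftrightarrow> (\<forall>i\<in>coords. a i = 0)"
  unfolding dot_def using finite_coords by (subst sum_nonneg_eq_0_iff) auto

lemma Inr_coords: "Inr (d, 1) \<in> coords"
  using S by (auto simp: coords_def)

lemma data_noise_coord: "(\<Sum>e\<in>UNIV. v $ e * data h e (Inr (d, 1))) = v $ d * (exp (h $ d / 2) / real S)"
  by (simp add: data_def if_distrib cong: if_cong)

text \<open>The matrix is the Gram matrix of the vectors \<open>data h d\<close>, which are linearly independent: their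
  noise blocks have disjoint supports, so each coefficient can be read off one noise coordinate.\<close>

lemma invertible_noisy_gram: "invertible (noisy_gram k x S h)"
proof -
  have "v = 0" if "noisy_gram k x S h *v v = 0" for v
  proof -
    let ?b = "\<lambda>i. \<Sum>d\<in>UNIV. v $ d * data h d i"
    have minus: "dot ?b b = (\<Sum>d\<in>UNIV. v $ d * dot (data h d) b)" for b
      using dot_linear[of "\<lambda>_. 0" v "data h" b] by (simp add: dot_def sum_negf)
    have "dot (data h d) ?b = (noisy_gram k x S h *v v) $ d" for d
      using minus[of "data h d"]
      by (simp add: dot_commute[of _ ?b] dot_data_data matrix_vector_mult_def
          noisy_gram_commute[of h _ d] mult.commute)
    then have "dot ?b ?b = 0"
      using that by (simp add: minus)
    then have "?b (Inr (d, 1)) = 0" for d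
      using Inr_coords unfolding dot_self_eq_0_iff by blast
    then show "v = 0"
      using S unfolding data_noise_coord by (simp add: vec_eq_iff)
  qed
  then show ?thesis
    by (simp add: invertible_left_inverse matrix_left_invertible_ker)
qed

lemma noisy_gram_inverse: "noisy_gram k x S h *v (matrix_inv (noisy_gram k x S h) *v v) = v"
  by (simp add: matrix_vector_mul_assoc matrix_inv_right_inverse[OF invertible_noisy_gram])

lemma noisy_gram_weights: "(\<Sum>d\<in>UNIV. weights h $ d * noisy_gram k x S h $ d $ e) = kernel_vec k x q $ e"
proof -
  have "(\<Sum>d\<in>UNIV. weights h $ d * noisy_gram k x S h $ d $ e) = (noisy_gram k x S h *v weights h) $ e"
    by (simp add: matrix_vector_mult_def noisy_gram_commute[of h _ e] mult.commute)
  then show ?thesis by (simp add: weights_def noisy_gram_inverse)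
qed

text \<open>Moves the inverse from the outputs to the kernel vector, which exhibits the regression mean as a
  fixed linear combination of the outputs; this uses the symmetry of the Gram matrix.\<close>

lemma regression_mean_eq: "regression_mean k x S q h y = weights h \<bullet> y"
proof -
  let ?G = "noisy_gram k x S h"
  have "transpose ?G = ?G"
    using noisy_gram_commute[of h] by (simp add: vec_eq_iff transpose_def)
  then have "regression_mean k x S q h y = (weights h v* ?G) \<bullet> (matrix_inv ?G *v y)"
    by (metis regression_mean_def weights_def noisy_gram_inverse transpose_matrix_vector)
  also have "\<dots> = weights h \<bullet> y"
    by (simp add: dot_lmul_matrix noisy_gram_inverse)
  finally show ?thesis .
qed

lemma dot_residual_data: "dot (residual h) (data h e) = 0"
  unfolding residual_def[abs_def] dot_linear
  by (simp add: dot_target_data dot_data_data noisy_gram_weights)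

lemma dot_residual_residual: "dot (residual h) (residual h) = regression_var k x S q h"
proof -
  have "dot (residual h) (residual h) = dot target (residual h)
      - (\<Sum>d\<in>UNIV. weights h $ d * dot (data h d) (residual h))"
    unfolding residual_def[of h, abs_def] by (rule dot_linear)
  also have "\<dots> = dot (residual h) target"
    by (simp add: dot_commute[of _ "residual h"] dot_residual_data)
  also have "\<dots> = k q q - weights h \<bullet> kernel_vec k x q"
    unfolding residual_def[abs_def] dot_linear
    by (simp add: dot_target_target dot_commute[of "data _ _"] dot_target_data inner_vec_def)
  finally show ?thesis
    by (simp add: regression_var_def weights_def inner_commute)
qed

text \<open>The variance is the squared norm of the residual. If the residual vanished, its noise coordinates
  would force all weights to be zero, so the residual would be \<open>target\<close>, whose squared norm \<open>k q q\<close> is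
  positive.\<close>

lemma regression_var_pos: "0 < regression_var k x S q h"
proof -
  have "dot (residual h) (residual h) \<noteq> 0"
  proof
    assume "dot (residual h) (residual h) = 0"
    then have zero: "residual h i = 0" if "i \<in> coords" for i
      using that dot_self_eq_0_iff by blast
    have "weights h $ d = 0" for d
      using zero[OF Inr_coords, of d] S
      unfolding residual_def data_noise_coord by (simp add: target_def)
    then have "target i = 0" if "i \<in> coords" for i
      using zero[OF that] by (simp add: residual_def)
    then have "k q q = 0"
      using dot_self_eq_0_iff[of target] by (simp add: dot_target_target)
    then show False using kernel_pos by simp
  qed
  moreover have "0 \<le> dot (residual h) (residual h)"
    unfolding dot_def by (rule sum_nonneg) simp
  ultimately show ?thesis by (simp add: dot_residual_residual)
qed

lemma borel_measurable_noisy_gram_inverse: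
  "(\<lambda>h. matrix_inv (noisy_gram k x S h) $ d $ e) \<in> borel_measurable borel"
proof (rule borel_measurable_matrix_inv[OF _ invertible_noisy_gram])
  fix i j
  have "(\<lambda>h :: real ^ 'n. exp (h $ i) / real S) \<in> borel_measurable borel"
    by measurable
  then show "(\<lambda>h. noisy_gram k x S h $ i $ j) \<in> borel_measurable borel"
    unfolding noisy_gram_component by (cases "i = j") simp_all
qed

lemma borel_measurable_regression_mean[measurable (raw)]:
  assumes "f \<in> borel_measurable L" "g \<in> borel_measurable L"
  shows "(\<lambda>z. regression_mean k x S q (f z) (g z)) \<in> borel_measurable L"
  unfolding regression_mean_def inner_vec_def matrix_vector_mult_def vec_lambda_beta inner_real_def
  by (intro borel_measurable_sum borel_measurable_times borel_measurable_const
      measurable_compose[OF assms(1) borel_measurable_noisy_gram_inverse]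
      measurable_compose[OF assms(2) borel_measurable_vec_nth])

lemma borel_measurable_regression_var[measurable]: "regression_var k x S q \<in> borel_measurable borel"
  unfolding regression_var_def[abs_def] inner_vec_def matrix_vector_mult_def vec_lambda_beta inner_real_def
  by (intro borel_measurable_diff borel_measurable_sum borel_measurable_times borel_measurable_const
      borel_measurable_noisy_gram_inverse)

text \<open>The decomposition of the process value at \<open>q\<close> into regression mean and residual.\<close>

lemma target_eq: "dot target z = (\<Sum>d\<in>UNIV. weights h $ d * dot (data h d) z) + dot (residual h) z"
  unfolding residual_def[abs_def] dot_linear by simp

text \<open>The unit vector along the residual is orthogonal to all data vectors, so resampling that component
  of \<open>z\<close> leaves the outputs unchanged and replaces the residual by its standard deviation times a
  fresh standard normal variable.\<close>

lemma gaussian_regression: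
  assumes H: "(\<lambda>(y, f). H y f) \<in> borel_measurable (borel \<Otimes>\<^sub>M borel)"
  shows "(\<integral>\<^sup>+z. H (\<chi> d. dot (data h d) z) (dot target z) \<partial>(\<Pi>\<^sub>M i\<in>coords. std_normal)) =
    (\<integral>\<^sup>+z. \<integral>\<^sup>+t. H (\<chi> d. dot (data h d) z)
        (regression_mean k x S q h (\<chi> d. dot (data h d) z) + sqrt (regression_var k x S q h) * t)
      \<partial>std_normal \<partial>(\<Pi>\<^sub>M i\<in>coords. std_normal))"
proof -
  define s where "s = sqrt (regression_var k x S q h)"
  have s: "0 < s" "s * s = dot (residual h) (residual h)"
    using regression_var_pos[of h] by (simp_all add: s_def dot_residual_residual)
  define a where "a i = residual h i / s" for i
  have dot_a: "dot a z = dot (residual h) z / s" for z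
    by (simp add: a_def dot_def sum_divide_distrib)
  have residual: "dot (residual h) z = s * dot a z" for z
    using s(1) by (simp add: dot_a)
  have "dot a a = dot (residual h) a / s"
    by (rule dot_a)
  also have "dot (residual h) a = dot (residual h) (residual h) / s"
    unfolding dot_commute[of "residual h" a] by (rule dot_a)
  finally have unit: "dot a a = 1"
    using s(1) by (simp flip: s(2))
  have orth: "dot (data h d) a = 0" for d
    unfolding dot_commute[of _ a] dot_a dot_residual_data by simp
  let ?z' = "\<lambda>z t. \<lambda>i\<in>coords. z i + (t - dot a z) * a i"
  have line: "dot b (\<lambda>i\<in>coords. z i + r * a i) = dot b z + r * dot b a" for b z r
    by (simp add: dot_def algebra_simps sum.distrib sum_distrib_left)
  have dot_meas: "dot b \<in> borel_measurable (\<Pi>\<^sub>M i\<in>coords. std_normal)" for b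
    unfolding dot_def[abs_def] by measurable
  have Y_meas: "(\<lambda>z. \<chi> d. dot (data h d) z) \<in> borel_measurable (\<Pi>\<^sub>M i\<in>coords. std_normal)"
    by (intro borel_measurable_vec_lambda dot_meas)
  have H_comp: "(\<lambda>z. H (\<chi> d. dot (data h d) z) (dot target z)) \<in> borel_measurable (\<Pi>\<^sub>M i\<in>coords. std_normal)"
  proof -
    have "(\<lambda>z. (\<chi> d. dot (data h d) z, dot target z)) \<in> (\<Pi>\<^sub>M i\<in>coords. std_normal) \<rightarrow>\<^sub>M borel \<Otimes>\<^sub>M borel"
      by (intro measurable_Pair Y_meas dot_meas)
    from measurable_compose[OF this H] show ?thesis by (simp only: prod.case)
  qed
  have data_eq: "dot (data h d) (?z' z t) = dot (data h d) z" for d z t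
    unfolding line orth by simp
  have target_eq': "dot target (?z' z t) =
      regression_mean k x S q h (\<chi> d. dot (data h d) z) + s * t" for z t
    unfolding target_eq[where h = h] residual regression_mean_eq line orth unit
    by (simp add: inner_vec_def algebra_simps)
  have "(\<integral>\<^sup>+z. H (\<chi> d. dot (data h d) z) (dot target z) \<partial>(\<Pi>\<^sub>M i\<in>coords. std_normal)) =
    (\<integral>\<^sup>+z. \<integral>\<^sup>+t. H (\<chi> d. dot (data h d) (?z' z t)) (dot target (?z' z t))
      \<partial>std_normal \<partial>(\<Pi>\<^sub>M i\<in>coords. std_normal))"
    unfolding dot_def[of a]
    by (rule resample_std_normal_component[OF finite_coords unit[unfolded dot_def] H_comp])
  then show ?thesis
    unfolding data_eq target_eq' s_def .
qed

end

section \<open>Tails of the predictive distribution\<close>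

lemma std_normal_tail: "measure std_normal {a..} = 1 / 2 * erfc (a / sqrt 2)"
proof -
  have "erfc (a / sqrt 2) = 2 / sqrt pi * (\<integral>t. indicator {a / sqrt 2..} t * exp (- t\<^sup>2) \<partial>lborel)"
    by (simp add: erfc_def set_lebesgue_integral_def)
  also have "(\<integral>t. indicator {a / sqrt 2..} t * exp (- t\<^sup>2) \<partial>lborel)
     = (1 / sqrt 2) * (\<integral>t. indicator {a / sqrt 2..} (t / sqrt 2) * exp (- (t / sqrt 2)\<^sup>2) \<partial>lborel)"
    using lborel_integral_real_affine[of "1 / sqrt 2" "\<lambda>t. indicator {a / sqrt 2..} t * exp (- t\<^sup>2)" 0]
    by simp
  also have "(\<integral>t. indicator {a / sqrt 2..} (t / sqrt 2) * exp (- (t / sqrt 2)\<^sup>2) \<partial>lborel)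
     = (\<integral>t. sqrt (2 * pi) * (indicator {a..} t * std_normal_density t) \<partial>lborel)"
    by (intro Bochner_Integration.integral_cong)
      (auto simp: indicator_def std_normal_density_def power_divide divide_le_cancel)
  also have "\<dots> = sqrt (2 * pi) * (\<integral>t. indicator {a..} t * std_normal_density t \<partial>lborel)"
    by simp
  also have "(\<integral>t. indicator {a..} t * std_normal_density t \<partial>lborel) = measure std_normal {a..}"
  proof -
    have "measure std_normal {a..} = (\<integral>t. indicator {a..} t \<partial>std_normal)"
      by simp
    also have "\<dots> = (\<integral>t. std_normal_density t * indicator {a..} t \<partial>lborel)"
      by (subst integral_density) auto
    finally show ?thesis by (simp add: mult.commute)
  qed
  finally show ?thesis
    by (simp add: real_sqrt_mult field_simps)
qed

lemma std_normal_affine_tail: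
  assumes "0 < \<sigma>"
  shows "measure std_normal {t. c \<le> m + \<sigma> * t} = 1 / 2 * erfc ((c - m) / (sqrt 2 * \<sigma>))"
proof -
  have "{t. c \<le> m + \<sigma> * t} = {(c - m) / \<sigma>..}"
    using assms by (auto simp: field_simps)
  then show ?thesis by (simp add: std_normal_tail mult.commute)
qed

lemma std_normal_singleton: "emeasure std_normal {c} = 0"
proof -
  have "AE t in lborel. t \<noteq> c" by (rule AE_lborel_singleton)
  then have "AE t in lborel. ennreal (std_normal_density t) * indicator {c} t = 0"
    by eventually_elim (auto simp: indicator_def)
  then show ?thesis
    by (simp add: emeasure_density nn_integral_0_iff_AE)
qed

lemma std_normal_interval_pos:
  assumes "a < b" shows "0 < emeasure std_normal {a<..b}"
proof -
  have "\<not> (AE t in lborel. ennreal (std_normal_density t) * indicator {a<..b} t = 0)"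
  proof
    assume "AE t in lborel. ennreal (std_normal_density t) * indicator {a<..b} t = 0"
    then have "AE t in lborel. t \<notin> {a<..b}"
    proof eventually_elim
      case (elim t)
      then show ?case
        using normal_density_pos[of 1 0 t] by (auto simp: indicator_def ennreal_eq_0_iff not_le split: if_splits)
    qed
    then have "emeasure lborel {a<..b} = 0"
      using AE_iff_null_sets[of "{a<..b}" lborel] by (auto simp: null_sets_def)
    then show False using assms by simp
  qed
  then have "emeasure std_normal {a<..b} \<noteq> 0"
    by (simp add: emeasure_density nn_integral_0_iff_AE)
  then show ?thesis by (simp add: zero_less_iff_neq_zero)
qed

lemma (in real_distribution) tail_eq_cdf:
  assumes "measure M {c} = 0"
  shows "measure M {c..} = 1 - cdf M c"
proof -
  have "measure M {..c} = measure M {..<c} + measure M {c}"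
    by (subst finite_measure_Union[symmetric]) (auto intro!: arg_cong[where f = "measure M"])
  moreover have "measure M {c..} = 1 - measure M {..<c}"
    using prob_compl[of "{..<c}"] by (simp add: Compl_eq_Diff_UNIV[symmetric] not_less flip: atLeast_def)
  ultimately show ?thesis using assms by (simp add: cdf_def)
qed

lemma (in real_distribution) tail_strict_antimono:
  assumes atomless: "\<And>c. measure M {c} = 0"
    and full: "\<And>a b. a < b \<Longrightarrow> 0 < measure M {a<..b}"
    and less: "a < b"
  shows "measure M {b..} < measure M {a..}"
  using cdf_diff_eq[OF less] full[OF less] by (simp add: tail_eq_cdf[OF atomless])

text \<open>Without atoms the distribution function is continuous, which gives a solution by the intermediate
  value theorem; charging every interval makes it strictly monotone, which gives uniqueness.\<close>

lemma (in real_distribution) ex1_tail_eq: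
  assumes atomless: "\<And>c. measure M {c} = 0"
    and full: "\<And>a b. a < b \<Longrightarrow> 0 < measure M {a<..b}"
    and p: "0 < p" "p < 1"
  shows "\<exists>!c. measure M {c..} = p"
proof -
  have "eventually (\<lambda>c. cdf M c < 1 - p) at_bot"
    using order_tendstoD(2)[OF cdf_lim_at_bot, of "1 - p"] p by simp
  then obtain a where a: "\<And>c. c \<le> a \<Longrightarrow> cdf M c < 1 - p"
    by (auto simp: eventually_at_bot_linorder)
  have "eventually (\<lambda>c. cdf M c > 1 - p) at_top"
    using order_tendstoD(1)[OF cdf_lim_at_top_prob, of "1 - p"] p by simp
  then obtain b where b: "\<And>c. b \<le> c \<Longrightarrow> cdf M c > 1 - p"
    by (auto simp: eventually_at_top_linorder)
  have "\<exists>c\<ge>min a b. c \<le> max a b \<and> cdf M c = 1 - p"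
  proof (rule IVT)
    show "cdf M (min a b) \<le> 1 - p" "1 - p \<le> cdf M (max a b)"
      using a[of "min a b"] b[of "max a b"] by simp_all
    show "\<forall>c. min a b \<le> c \<and> c \<le> max a b \<longrightarrow> isCont (cdf M) c"
      by (simp add: isCont_cdf atomless)
  qed simp
  then obtain c where "cdf M c = 1 - p" by blast
  then have "measure M {c..} = p"
    by (simp add: tail_eq_cdf[OF atomless])
  moreover have "c' = c" if "measure M {c'..} = p" "measure M {c..} = p" for c c'
    using tail_strict_antimono[OF atomless full, of c c'] tail_strict_antimono[OF atomless full, of c' c] that
    by (cases c c' rule: linorder_cases) auto
  ultimately show ?thesis by blast
qed

context feature_regression
begin

text \<open>The predictive law at \<open>q\<close> given outputs \<open>y\<close>: draw the log-variances from \<open>\<mu>\<close>, then the value from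
  the corresponding regression normal law.\<close>

definition mixture :: "(real ^ 'n) measure \<Rightarrow> real ^ 'n \<Rightarrow> real measure" where
  "mixture \<mu> y = distr (\<mu> \<Otimes>\<^sub>M std_normal) borel
     (\<lambda>(h, t). regression_mean k x S q h y + sqrt (regression_var k x S q h) * t)"

context
  fixes \<mu> :: "(real ^ 'n) measure" and y :: "real ^ 'n"
  assumes \<mu>: "\<mu> \<in> space (prob_algebra borel)"
begin

lemma sets_mixing[measurable_cong]: "sets \<mu> = sets borel"
  using \<mu> by (simp add: space_prob_algebra)

lemma measurable_mixture:
  "(\<lambda>(h, t). regression_mean k x S q h y + sqrt (regression_var k x S q h) * t)
     \<in> \<mu> \<Otimes>\<^sub>M std_normal \<rightarrow>\<^sub>M borel"
  by measurable

lemma real_distribution_mixture: "real_distribution (mixture \<mu> y)"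
proof -
  interpret prob_space \<mu>
    using \<mu> by (simp add: space_prob_algebra)
  interpret pair_prob_space \<mu> std_normal ..
  show ?thesis
    unfolding mixture_def using measurable_mixture by (rule real_distribution_distr)
qed

lemma emeasure_mixture:
  assumes "A \<in> sets borel"
  shows "emeasure (mixture \<mu> y) A = (\<integral>\<^sup>+h. emeasure std_normal
    {t. regression_mean k x S q h y + sqrt (regression_var k x S q h) * t \<in> A} \<partial>\<mu>)"
proof -
  have space: "space \<mu> = UNIV"
    using sets_eq_imp_space_eq[OF sets_mixing] by simp
  show ?thesis
    unfolding mixture_def using assms measurable_sets[OF measurable_mixture assms]
    by (auto simp: emeasure_distr[OF measurable_mixture] std_normal.emeasure_pair_measure_alt
        space space_pair_measure intro!: nn_integral_cong arg_cong[where f = "emeasure std_normal"])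
qed

lemma mixture_atomless: "measure (mixture \<mu> y) {c} = 0"
proof -
  have "{t. m + sqrt (regression_var k x S q h) * t = c} = {(c - m) / sqrt (regression_var k x S q h)}" for m h
    using regression_var_pos[of h] by (auto simp: field_simps)
  then have "emeasure (mixture \<mu> y) {c} = 0"
    by (simp add: emeasure_mixture std_normal_singleton)
  then show ?thesis by (simp add: measure_def)
qed

lemma mixture_interval_pos:
  assumes "a < b" shows "0 < measure (mixture \<mu> y) {a<..b}"
proof -
  interpret R: real_distribution "mixture \<mu> y" by (rule real_distribution_mixture)
  interpret prob_space \<mu>
    using \<mu> by (simp add: space_prob_algebra)
  let ?s = "\<lambda>h. sqrt (regression_var k x S q h)"
  let ?A = "\<lambda>h. {t. regression_mean k x S q h y + ?s h * t \<in> {a<..b}}"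
  have "?A h = {(a - regression_mean k x S q h y) / ?s h <.. (b - regression_mean k x S q h y) / ?s h}" for h
    using regression_var_pos[of h] by (auto simp: field_simps)
  then have pos: "0 < emeasure std_normal (?A h)" for h
    using assms regression_var_pos[of h] by (simp add: std_normal_interval_pos divide_strict_right_mono)
  have "(\<lambda>h. emeasure std_normal (Pair h -`
      ((\<lambda>(h, t). regression_mean k x S q h y + ?s h * t) -` {a<..b} \<inter> space (\<mu> \<Otimes>\<^sub>M std_normal))))
      \<in> borel_measurable \<mu>"
    by (intro std_normal.measurable_emeasure_Pair measurable_sets[OF measurable_mixture]) simp
  also have "(\<lambda>h. Pair h -` ((\<lambda>(h, t). regression_mean k x S q h y + ?s h * t) -` {a<..b}
      \<inter> space (\<mu> \<Otimes>\<^sub>M std_normal))) = ?A"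
    using sets_eq_imp_space_eq[OF sets_mixing] by (auto simp: space_pair_measure)
  finally have meas: "(\<lambda>h. emeasure std_normal (?A h)) \<in> borel_measurable \<mu>" .
  have "emeasure (mixture \<mu> y) {a<..b} \<noteq> 0"
  proof
    assume "emeasure (mixture \<mu> y) {a<..b} = 0"
    then have "AE h in \<mu>. emeasure std_normal (?A h) = 0"
      using meas by (simp add: emeasure_mixture nn_integral_0_iff_AE)
    then have "AE h in \<mu>. False"
      by eventually_elim (use pos in \<open>metis less_irrefl\<close>)
    then show False by simp
  qed
  then show ?thesis
    by (simp add: R.emeasure_eq_measure zero_less_measure_iff)
qed

end

text \<open>Makes the results on distribution functions of real distributions applicable to \<open>tail_delta\<close>.\<close>

lemma tail_delta_eq_mixture:
  assumes "\<kappa> y \<in> space (prob_algebra borel)"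
  shows "tail_delta k x S \<kappa> \<gamma> q y = measure (mixture (\<kappa> y) y) {\<gamma>..}"
proof -
  interpret R: real_distribution "mixture (\<kappa> y) y"
    using assms by (rule real_distribution_mixture)
  interpret prob_space "\<kappa> y"
    using assms by (simp add: space_prob_algebra)
  note [measurable_cong] = sets_mixing[OF assms]
  let ?s = "\<lambda>h. sqrt (regression_var k x S q h)"
  let ?T = "\<lambda>h. 1 / 2 * erfc ((\<gamma> - regression_mean k x S q h y) / (sqrt 2 * ?s h))"
  have T: "?T h = measure std_normal {t. \<gamma> \<le> regression_mean k x S q h y + ?s h * t}" for h
    using regression_var_pos[of h] by (subst std_normal_affine_tail) simp_all
  have "tail_delta k x S \<kappa> \<gamma> q y = (\<integral>h. ?T h \<partial>\<kappa> y)"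
    unfolding tail_delta_def regression_mean_def regression_var_def by simp
  also have "\<dots> = (\<integral>h. measure std_normal {t. \<gamma> \<le> regression_mean k x S q h y + ?s h * t} \<partial>\<kappa> y)"
    by (simp only: T)
  also have "\<dots> = enn2real (\<integral>\<^sup>+h. ennreal (measure std_normal
      {t. \<gamma> \<le> regression_mean k x S q h y + ?s h * t}) \<partial>\<kappa> y)"
  proof (rule integral_eq_nn_integral)
    have "(\<lambda>h. measure std_normal (Pair h -`
        ((\<lambda>(h, t). regression_mean k x S q h y + ?s h * t) -` {\<gamma>..} \<inter> space (\<kappa> y \<Otimes>\<^sub>M std_normal))))
        \<in> borel_measurable (\<kappa> y)"
      unfolding measure_def
      by (intro borel_measurable_enn2real std_normal.measurable_emeasure_Pair
          measurable_sets[OF measurable_mixture[OF assms]]) simp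
    also have "(\<lambda>h. Pair h -` ((\<lambda>(h, t). regression_mean k x S q h y + ?s h * t) -` {\<gamma>..}
        \<inter> space (\<kappa> y \<Otimes>\<^sub>M std_normal))) = (\<lambda>h. {t. \<gamma> \<le> regression_mean k x S q h y + ?s h * t})"
      using sets_eq_imp_space_eq[OF sets_mixing[OF assms]] by (auto simp: space_pair_measure)
    finally show "(\<lambda>h. measure std_normal {t. \<gamma> \<le> regression_mean k x S q h y + ?s h * t})
        \<in> borel_measurable (\<kappa> y)" .
  qed simp
  also have "(\<integral>\<^sup>+h. ennreal (measure std_normal
      {t. \<gamma> \<le> regression_mean k x S q h y + ?s h * t}) \<partial>\<kappa> y) = emeasure (mixture (\<kappa> y) y) {\<gamma>..}"
    by (simp add: emeasure_mixture[OF assms] std_normal.emeasure_eq_measure)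
  finally show ?thesis by (simp add: measure_def)
qed

lemma tail_delta_strict_antimono:
  assumes "\<kappa> y \<in> space (prob_algebra borel)" and "\<gamma> < \<gamma>'"
  shows "tail_delta k x S \<kappa> \<gamma>' q y < tail_delta k x S \<kappa> \<gamma> q y"
  unfolding tail_delta_eq_mixture[where \<kappa> = \<kappa>, OF assms(1)]
  using assms real_distribution.tail_strict_antimono[OF real_distribution_mixture]
    mixture_atomless mixture_interval_pos by blast

lemma ex1_tail_delta_eq:
  assumes "\<kappa> y \<in> space (prob_algebra borel)" and "0 < p" "p < 1"
  shows "\<exists>!\<gamma>. tail_delta k x S \<kappa> \<gamma> q y = p"
  unfolding tail_delta_eq_mixture[where \<kappa> = \<kappa>, OF assms(1)]
  using assms real_distribution.ex1_tail_eq[OF real_distribution_mixture]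
    mixture_atomless mixture_interval_pos by blast

text \<open>The iterated integral in which \<open>tail_delta\<close> arises when the log-variances are averaged out.\<close>

lemma nn_tail_delta:
  assumes "\<kappa> y \<in> space (prob_algebra borel)"
  shows "ennreal (tail_delta k x S \<kappa> \<gamma> q y) = (\<integral>\<^sup>+h. \<integral>\<^sup>+t. indicator {\<gamma>..}
    (regression_mean k x S q h y + sqrt (regression_var k x S q h) * t) \<partial>std_normal \<partial>\<kappa> y)"
proof -
  interpret R: real_distribution "mixture (\<kappa> y) y"
    using assms by (rule real_distribution_mixture)
  have "(\<integral>\<^sup>+t. indicator {\<gamma>..} (m + s * t) \<partial>std_normal) = emeasure std_normal {t. m + s * t \<in> {\<gamma>..}}" for m s :: real
  proof -
    have "(\<integral>\<^sup>+t. indicator {\<gamma>..} (m + s * t) \<partial>std_normal) = (\<integral>\<^sup>+t. indicator {t. m + s * t \<in> {\<gamma>..}} t \<partial>std_normal)"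
      by (intro nn_integral_cong) (simp add: indicator_def)
    then show ?thesis by simp
  qed
  then show ?thesis
    by (simp add: tail_delta_eq_mixture[where \<kappa> = \<kappa>, OF assms] emeasure_mixture[OF assms]
        flip: R.emeasure_eq_measure)
qed

end

section \<open>The data model in feature coordinates\<close>

text \<open>The rows of the factor \<open>A\<close> of the covariance matrix, reindexed from an enumeration of \<open>P\<close> to the
  points themselves, serve as feature vectors.\<close>

lemma gaussian_process_features:
  fixes F :: "'w \<Rightarrow> 'a \<Rightarrow> real"
  assumes gp: "gaussian_process M X F k" and P: "finite P" "P \<subseteq> X"
  obtains \<psi> :: "'a \<Rightarrow> nat \<Rightarrow> real" where
    "\<And>a b. a \<in> P \<Longrightarrow> b \<in> P \<Longrightarrow> k a b = (\<Sum>m<card P. \<psi> a m * \<psi> b m)"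
    "distr M (\<Pi>\<^sub>M a\<in>P. borel) (\<lambda>\<omega>. \<lambda>a\<in>P. F \<omega> a) =
     distr (\<Pi>\<^sub>M m\<in>{..<card P}. std_normal) (\<Pi>\<^sub>M a\<in>P. borel) (\<lambda>z. \<lambda>a\<in>P. \<Sum>m<card P. \<psi> a m * z m)"
proof -
  let ?N = "card P"
  obtain p where p: "bij_betw p {..<?N} P"
    using ex_bij_betw_nat_finite[OF P(1)] by (auto simp: atLeast0LessThan)
  define idx where "idx = the_inv_into {..<?N} p"
  have idx: "idx a < ?N" "p (idx a) = a" if "a \<in> P" for a
    using that p the_inv_into_into[of p "{..<?N}" a "{..<?N}"] f_the_inv_into_f_bij_betw[OF p, of a]
    by (auto simp: idx_def bij_betw_def)
  have F[measurable]: "(\<lambda>\<omega>. F \<omega> a) \<in> borel_measurable M" if "a \<in> P" for a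
    using gp that P(2) by (auto simp: gaussian_process_def)
  have "centered_normal_law ?N (\<lambda>i j. k (p i) (p j))
      (distr M (\<Pi>\<^sub>M i\<in>{..<?N}. borel) (\<lambda>\<omega>. \<lambda>i\<in>{..<?N}. F \<omega> (p i)))"
    using gp p P(2) unfolding gaussian_process_def bij_betw_def by blast
  then obtain A where A: "\<And>i j. i < ?N \<Longrightarrow> j < ?N \<Longrightarrow> (\<Sum>m<?N. A i m * A j m) = k (p i) (p j)"
    and law: "distr M (\<Pi>\<^sub>M i\<in>{..<?N}. borel) (\<lambda>\<omega>. \<lambda>i\<in>{..<?N}. F \<omega> (p i)) =
      distr (\<Pi>\<^sub>M i\<in>{..<?N}. std_normal) (\<Pi>\<^sub>M i\<in>{..<?N}. borel) (\<lambda>z. \<lambda>i\<in>{..<?N}. \<Sum>m<?N. A i m * z m)"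
    unfolding centered_normal_law_def by blast
  define \<psi> where "\<psi> a = A (idx a)" for a
  let ?r = "\<lambda>\<phi>. \<lambda>a\<in>P. \<phi> (idx a) :: real"
  have r[measurable]: "?r \<in> (\<Pi>\<^sub>M i\<in>{..<?N}. borel) \<rightarrow>\<^sub>M (\<Pi>\<^sub>M a\<in>P. borel)"
    using idx by (intro measurable_restrict measurable_component_singleton) auto
  have F': "(\<lambda>\<omega>. \<lambda>i\<in>{..<?N}. F \<omega> (p i)) \<in> M \<rightarrow>\<^sub>M (\<Pi>\<^sub>M i\<in>{..<?N}. borel)"
    using p by (intro measurable_restrict F) (auto simp: bij_betw_def)
  have A': "(\<lambda>z. \<lambda>i\<in>{..<?N}. \<Sum>m<?N. A i m * z m) \<in> (\<Pi>\<^sub>M i\<in>{..<?N}. std_normal) \<rightarrow>\<^sub>M (\<Pi>\<^sub>M i\<in>{..<?N}. borel)"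
    by measurable
  have "distr M (\<Pi>\<^sub>M a\<in>P. borel) (\<lambda>\<omega>. \<lambda>a\<in>P. F \<omega> a) =
      distr (distr M (\<Pi>\<^sub>M i\<in>{..<?N}. borel) (\<lambda>\<omega>. \<lambda>i\<in>{..<?N}. F \<omega> (p i))) (\<Pi>\<^sub>M a\<in>P. borel) ?r"
    unfolding distr_distr[OF r F'] comp_def
    by (intro distr_cong refl restrict_ext) (simp add: idx)
  also have "\<dots> = distr (\<Pi>\<^sub>M m\<in>{..<?N}. std_normal) (\<Pi>\<^sub>M a\<in>P. borel) (\<lambda>z. \<lambda>a\<in>P. \<Sum>m<?N. \<psi> a m * z m)"
    unfolding law distr_distr[OF r A'] comp_def
    by (intro distr_cong refl restrict_ext) (simp add: idx \<psi>_def)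
  finally show ?thesis
    using that[of \<psi>] A idx by (simp add: \<psi>_def)
qed

text \<open>Joins the process coordinates and the noises into a single standard normal vector.\<close>

lemma nn_integral_PiM_std_normal_Plus:
  fixes I :: "'i set" and J :: "'j set"
  assumes I: "finite I" and J: "finite J"
    and G: "G \<in> borel_measurable (\<Pi>\<^sub>M i\<in>I <+> J. std_normal)"
  shows "(\<integral>\<^sup>+z. G z \<partial>(\<Pi>\<^sub>M i\<in>I <+> J. std_normal)) =
    (\<integral>\<^sup>+a. \<integral>\<^sup>+b. G (\<lambda>i\<in>I <+> J. case_sum a b i) \<partial>(\<Pi>\<^sub>M j\<in>J. std_normal) \<partial>(\<Pi>\<^sub>M i\<in>I. std_normal))"
proof -
  interpret K: product_sigma_finite "\<lambda>_::'i + 'j. std_normal" by unfold_locales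
  interpret I: product_sigma_finite "\<lambda>_::'i. std_normal" by unfold_locales
  interpret J: product_sigma_finite "\<lambda>_::'j. std_normal" by unfold_locales
  interpret I: finite_product_sigma_finite "\<lambda>_::'i. std_normal" I by standard fact
  interpret J: finite_product_sigma_finite "\<lambda>_::'j. std_normal" J by standard fact
  let ?I = "\<Pi>\<^sub>M i\<in>I. std_normal" and ?J = "\<Pi>\<^sub>M j\<in>J. std_normal" and ?K = "\<Pi>\<^sub>M i\<in>I <+> J. std_normal"
  let ?c = "\<lambda>(a, b). \<lambda>i\<in>I <+> J. case_sum a b i :: real"
  have c: "?c \<in> ?I \<Otimes>\<^sub>M ?J \<rightarrow>\<^sub>M ?K"
    unfolding split_beta
  proof (rule measurable_restrict)
    fix i assume "i \<in> I <+> J"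
    then show "(\<lambda>z. case_sum (fst z) (snd z) i) \<in> ?I \<Otimes>\<^sub>M ?J \<rightarrow>\<^sub>M std_normal"
      by (cases i) auto
  qed
  have eq: "distr (?I \<Otimes>\<^sub>M ?J) ?K ?c = ?K"
  proof (rule K.PiM_eqI)
    fix A :: "'i + 'j \<Rightarrow> real set" assume A: "\<And>i. i \<in> I <+> J \<Longrightarrow> A i \<in> sets std_normal"
    have "?c -` Pi\<^sub>E (I <+> J) A \<inter> space (?I \<Otimes>\<^sub>M ?J) = (\<Pi>\<^sub>E i\<in>I. A (Inl i)) \<times> (\<Pi>\<^sub>E j\<in>J. A (Inr j))"
      unfolding Plus_def by (auto simp: space_pair_measure space_PiM PiE_iff ball_Un)
    moreover have "emeasure (?I \<Otimes>\<^sub>M ?J) ((\<Pi>\<^sub>E i\<in>I. A (Inl i)) \<times> (\<Pi>\<^sub>E j\<in>J. A (Inr j))) =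
        (\<Prod>i\<in>I. emeasure std_normal (A (Inl i))) * (\<Prod>j\<in>J. emeasure std_normal (A (Inr j)))"
      using A[OF InlI] A[OF InrI] I J
      by (subst J.emeasure_pair_measure_Times)
        (auto intro!: sets_PiM_I_finite simp: I.emeasure_PiM J.emeasure_PiM)
    moreover have "Pi\<^sub>E (I <+> J) A \<in> sets ?K"
      using A I J by (intro sets_PiM_I_finite) auto
    ultimately show "emeasure (distr (?I \<Otimes>\<^sub>M ?J) ?K ?c) (Pi\<^sub>E (I <+> J) A)
        = (\<Prod>i\<in>I <+> J. emeasure std_normal (A i))"
      using I J by (simp add: emeasure_distr[OF c] prod.Plus)
  qed (use I J in simp_all)
  have "(\<integral>\<^sup>+z. G z \<partial>?K) = (\<integral>\<^sup>+z. G z \<partial>distr (?I \<Otimes>\<^sub>M ?J) ?K ?c)"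
    by (simp only: eq)
  also have "\<dots> = (\<integral>\<^sup>+z. G (?c z) \<partial>(?I \<Otimes>\<^sub>M ?J))"
    using G by (intro nn_integral_distr[OF c]) simp
  also have "\<dots> = (\<integral>\<^sup>+a. \<integral>\<^sup>+b. G (?c (a, b)) \<partial>?J \<partial>?I)"
    by (rule J.nn_integral_fst[symmetric]) (rule measurable_compose[OF c G])
  finally show ?thesis by simp
qed

text \<open>The single equation \<open>joint_law\<close> records that the normalised noises, the process values and the
  log-variances are independent, that the noises are standard normal, and that the process values have
  the law given by the features.\<close>

locale gaussian_data = feature_regression k x S q N \<psi> + prob_space M
  for k :: "'a \<Rightarrow> 'a \<Rightarrow> real" and x :: "'n::finite \<Rightarrow> 'a" and S :: nat and q :: 'a
    and N :: nat and \<psi> :: "'a \<Rightarrow> nat \<Rightarrow> real" and M :: "'w measure" +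
  fixes F :: "'w \<Rightarrow> 'a \<Rightarrow> real" and hD yE :: "'w \<Rightarrow> real ^ 'n" and \<zeta> :: "'w \<Rightarrow> 'n \<times> nat \<Rightarrow> real"
  assumes F_measurable: "(\<lambda>\<omega>. \<lambda>a\<in>insert q (range x). F \<omega> a) \<in> M \<rightarrow>\<^sub>M (\<Pi>\<^sub>M a\<in>insert q (range x). borel)"
    and hD_measurable: "hD \<in> borel_measurable M"
    and \<zeta>_measurable: "(\<lambda>\<omega>. restrict (\<zeta> \<omega>) (UNIV \<times> {1..S})) \<in> M \<rightarrow>\<^sub>M (\<Pi>\<^sub>M ds\<in>UNIV \<times> {1..S}. borel)"
    and joint_law: "distr M ((\<Pi>\<^sub>M ds\<in>UNIV \<times> {1..S}. borel) \<Otimes>\<^sub>M ((\<Pi>\<^sub>M a\<in>insert q (range x). borel) \<Otimes>\<^sub>M borel))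
        (\<lambda>\<omega>. (restrict (\<zeta> \<omega>) (UNIV \<times> {1..S}), (\<lambda>a\<in>insert q (range x). F \<omega> a), hD \<omega>)) =
      (\<Pi>\<^sub>M ds\<in>UNIV \<times> {1..S}. std_normal) \<Otimes>\<^sub>M
        (distr (\<Pi>\<^sub>M m\<in>{..<N}. std_normal) (\<Pi>\<^sub>M a\<in>insert q (range x). borel)
           (\<lambda>z. \<lambda>a\<in>insert q (range x). \<Sum>m<N. \<psi> a m * z m) \<Otimes>\<^sub>M distr M borel hD)"
    and yE_eq: "\<And>\<omega>. \<omega> \<in> space M \<Longrightarrow>
        yE \<omega> = (\<chi> d. F \<omega> (x d) + (\<Sum>s = 1..S. exp (hD \<omega> $ d / 2) / real S * \<zeta> \<omega> (d, s)))"
begin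

lemma yE_measurable: "yE \<in> borel_measurable M"
proof -
  have [measurable]: "(\<lambda>\<omega>. F \<omega> (x d)) \<in> borel_measurable M" for d
    using measurable_compose[OF F_measurable measurable_component_singleton[of "x d"]] by simp
  have [measurable]: "(\<lambda>\<omega>. \<zeta> \<omega> (d, s)) \<in> borel_measurable M" if "s \<in> {1..S}" for d s
    using measurable_compose[OF \<zeta>_measurable measurable_component_singleton[of "(d, s)"]] that by simp
  note hD_measurable[measurable]
  have "(\<lambda>\<omega>. \<chi> d. F \<omega> (x d) + (\<Sum>s = 1..S. exp (hD \<omega> $ d / 2) / real S * \<zeta> \<omega> (d, s)))
      \<in> borel_measurable M"
    by measurable
  then show ?thesis
    by (rule measurable_cong[THEN iffD1, rotated]) (simp add: yE_eq)
qed

lemma F_target_measurable: "(\<lambda>\<omega>. F \<omega> q) \<in> borel_measurable M"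
  using measurable_compose[OF F_measurable measurable_component_singleton[of q]] by simp

text \<open>By independence the log-variances can be integrated last, so that they are frozen while the
  regression identity is applied.\<close>

lemma nn_integral_data:
  assumes H: "(\<lambda>(h, y, f). H h y f) \<in> borel_measurable (borel \<Otimes>\<^sub>M borel \<Otimes>\<^sub>M borel)"
  shows "(\<integral>\<^sup>+\<omega>. H (hD \<omega>) (yE \<omega>) (F \<omega> q) \<partial>M) =
    (\<integral>\<^sup>+h. \<integral>\<^sup>+z. H h (\<chi> d. dot (data h d) z) (dot target z) \<partial>(\<Pi>\<^sub>M i\<in>coords. std_normal) \<partial>distr M borel hD)"
proof -
  let ?P = "insert q (range x)" and ?J = "UNIV \<times> {1..S} :: ('n \<times> nat) set"
  let ?BP = "\<Pi>\<^sub>M a\<in>?P. borel :: real measure" and ?BJ = "\<Pi>\<^sub>M ds\<in>?J. borel :: real measure"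
  let ?NJ = "\<Pi>\<^sub>M ds\<in>?J. std_normal" and ?NN = "\<Pi>\<^sub>M m\<in>{..<N}. std_normal"
  let ?L = "\<lambda>z. \<lambda>a\<in>?P. \<Sum>m<N. \<psi> a m * z m"
  let ?Y = "\<lambda>\<zeta> \<phi> h. \<chi> d. \<phi> (x d) + (\<Sum>s = 1..S. exp (h $ d / 2) / real S * \<zeta> (d, s)) :: real ^ 'n"
  interpret J: product_prob_space "\<lambda>_ :: 'n \<times> nat. std_normal" ?J by unfold_locales
  interpret K: product_prob_space "\<lambda>_ :: nat. std_normal" "{..<N}" by unfold_locales
  have L[measurable]: "?L \<in> ?NN \<rightarrow>\<^sub>M ?BP" by measurable
  interpret D: prob_space "distr M borel hD" by (rule prob_space_distr) (rule hD_measurable)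
  interpret L: prob_space "distr ?NN ?BP ?L" by (rule K.prob_space_distr) (rule L)
  interpret LD: pair_prob_space "distr ?NN ?BP ?L" "distr M borel hD" ..
  interpret JLD: pair_prob_space ?NJ "distr ?NN ?BP ?L \<Otimes>\<^sub>M distr M borel hD" ..
  note hD_measurable[measurable] F_measurable[measurable] \<zeta>_measurable[measurable]
  have Y[measurable]: "(\<lambda>(\<zeta>, \<phi>, h). ?Y \<zeta> \<phi> h) \<in> ?BJ \<Otimes>\<^sub>M (?BP \<Otimes>\<^sub>M borel) \<rightarrow>\<^sub>M borel"
    unfolding split_beta by measurable
  have G: "(\<lambda>(\<zeta>, \<phi>, h). H h (?Y \<zeta> \<phi> h) (\<phi> q)) \<in> borel_measurable (?BJ \<Otimes>\<^sub>M (?BP \<Otimes>\<^sub>M borel))"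
  proof -
    have "(\<lambda>(\<zeta>, \<phi>, h). (h, ?Y \<zeta> \<phi> h, \<phi> q)) \<in> ?BJ \<Otimes>\<^sub>M (?BP \<Otimes>\<^sub>M borel) \<rightarrow>\<^sub>M borel \<Otimes>\<^sub>M borel \<Otimes>\<^sub>M borel"
      unfolding split_beta by measurable
    from measurable_compose[OF this H] show ?thesis
      by (simp add: split_beta)
  qed
  have "(\<integral>\<^sup>+\<omega>. H (hD \<omega>) (yE \<omega>) (F \<omega> q) \<partial>M) =
      (\<integral>\<^sup>+\<omega>. (\<lambda>(\<zeta>, \<phi>, h). H h (?Y \<zeta> \<phi> h) (\<phi> q)) (restrict (\<zeta> \<omega>) ?J, (\<lambda>a\<in>?P. F \<omega> a), hD \<omega>) \<partial>M)"
    by (intro nn_integral_cong) (simp add: yE_eq)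
  also have "\<dots> = (\<integral>\<^sup>+(\<zeta>, \<phi>, h). H h (?Y \<zeta> \<phi> h) (\<phi> q)
      \<partial>distr M (?BJ \<Otimes>\<^sub>M (?BP \<Otimes>\<^sub>M borel)) (\<lambda>\<omega>. (restrict (\<zeta> \<omega>) ?J, (\<lambda>a\<in>?P. F \<omega> a), hD \<omega>)))"
  proof (rule nn_integral_distr[symmetric])
    show "(\<lambda>\<omega>. (restrict (\<zeta> \<omega>) ?J, (\<lambda>a\<in>?P. F \<omega> a), hD \<omega>)) \<in> M \<rightarrow>\<^sub>M ?BJ \<Otimes>\<^sub>M (?BP \<Otimes>\<^sub>M borel)"
      by (intro measurable_Pair \<zeta>_measurable F_measurable hD_measurable)
  qed (subst measurable_distr_eq1, rule G)
  also have "\<dots> = (\<integral>\<^sup>+(\<zeta>, \<phi>, h). H h (?Y \<zeta> \<phi> h) (\<phi> q)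
      \<partial>(?NJ \<Otimes>\<^sub>M (distr ?NN ?BP ?L \<Otimes>\<^sub>M distr M borel hD)))"
    by (simp only: joint_law)
  also have "\<dots> = (\<integral>\<^sup>+h. \<integral>\<^sup>+z. H h (\<chi> d. dot (data h d) z) (dot target z) \<partial>(\<Pi>\<^sub>M i\<in>coords. std_normal) \<partial>distr M borel hD)"
  proof -
    let ?G = "\<lambda>(\<zeta>, \<phi>, h). H h (?Y \<zeta> \<phi> h) (\<phi> q)"
    have G': "?G \<in> borel_measurable (?NJ \<Otimes>\<^sub>M (distr ?NN ?BP ?L \<Otimes>\<^sub>M distr M borel hD))"
    proof -
      have "sets (?BJ \<Otimes>\<^sub>M (?BP \<Otimes>\<^sub>M borel)) = sets (?NJ \<Otimes>\<^sub>M (distr ?NN ?BP ?L \<Otimes>\<^sub>M distr M borel hD))"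
        by (intro sets_pair_measure_cong sets_PiM_cong) simp_all
      with G show ?thesis
        using measurable_cong_sets[OF _ refl] by blast
    qed
    have G2: "(\<lambda>p. \<integral>\<^sup>+\<zeta>. ?G (\<zeta>, p) \<partial>?NJ) \<in> borel_measurable (distr ?NN ?BP ?L \<Otimes>\<^sub>M distr M borel hD)"
      using G' by measurable
    have "(\<integral>\<^sup>+p. ?G p \<partial>(?NJ \<Otimes>\<^sub>M (distr ?NN ?BP ?L \<Otimes>\<^sub>M distr M borel hD)))
        = (\<integral>\<^sup>+h. \<integral>\<^sup>+\<phi>. \<integral>\<^sup>+\<zeta>. ?G (\<zeta>, \<phi>, h) \<partial>?NJ \<partial>distr ?NN ?BP ?L \<partial>distr M borel hD)"
      by (simp only: JLD.nn_integral_snd[OF G', symmetric] LD.nn_integral_snd[OF G2, symmetric])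
    also have "\<dots> = (\<integral>\<^sup>+h. \<integral>\<^sup>+z. H h (\<chi> d. dot (data h d) z) (dot target z)
        \<partial>(\<Pi>\<^sub>M i\<in>coords. std_normal) \<partial>distr M borel hD)"
    proof (rule nn_integral_cong)
      fix h
      let ?D = "\<lambda>z. H h (\<chi> d. dot (data h d) z) (dot target z)"
      have dot_meas: "dot b \<in> borel_measurable (\<Pi>\<^sub>M i\<in>coords. std_normal)" for b
        unfolding dot_def[abs_def] by measurable
      have "(\<lambda>z. (h, (\<chi> d. dot (data h d) z), dot target z))
          \<in> (\<Pi>\<^sub>M i\<in>coords. std_normal) \<rightarrow>\<^sub>M borel \<Otimes>\<^sub>M borel \<Otimes>\<^sub>M borel"
        by (intro measurable_Pair measurable_const borel_measurable_vec_lambda dot_meas) simp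
      from measurable_compose[OF this H]
      have D: "?D \<in> borel_measurable (\<Pi>\<^sub>M i\<in>coords. std_normal)"
        by simp
      have G3: "(\<lambda>\<phi>. \<integral>\<^sup>+\<zeta>. ?G (\<zeta>, \<phi>, h) \<partial>?NJ) \<in> borel_measurable (distr ?NN ?BP ?L)"
        using measurable_compose[OF measurable_Pair2'[of h "distr M borel hD" "distr ?NN ?BP ?L"] G2] by simp
      have "(\<integral>\<^sup>+\<phi>. \<integral>\<^sup>+\<zeta>. ?G (\<zeta>, \<phi>, h) \<partial>?NJ \<partial>distr ?NN ?BP ?L)
          = (\<integral>\<^sup>+z. \<integral>\<^sup>+\<zeta>. ?G (\<zeta>, ?L z, h) \<partial>?NJ \<partial>?NN)"
        by (rule nn_integral_distr[OF L G3])
      also have "\<dots> = (\<integral>\<^sup>+z. \<integral>\<^sup>+\<zeta>. ?D (\<lambda>i\<in>coords. case_sum z \<zeta> i) \<partial>?NJ \<partial>?NN)"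
      proof (intro nn_integral_cong)
        fix z :: "nat \<Rightarrow> real" and \<zeta> :: "'n \<times> nat \<Rightarrow> real"
        let ?c = "\<lambda>i\<in>coords. case_sum z \<zeta> i"
        have coords: "Inl m \<in> coords" "Inr (d, s) \<in> coords" if "m < N" "s \<in> {1..S}" for m d s
          using that by (auto simp: coords_def)
        have "dot (data h d) ?c = (\<Sum>m<N. \<psi> (x d) m * z m) +
            (\<Sum>d'\<in>UNIV. if d' = d then (\<Sum>s = 1..S. exp (h $ d / 2) / real S * \<zeta> (d, s)) else 0)" for d
          unfolding dot_def sum_coords
          by (intro arg_cong2[where f = "(+)"] sum.cong) (auto simp: data_def coords_def intro!: sum.cong)
        then have "dot (data h d) ?c = ?L z (x d) + (\<Sum>s = 1..S. exp (h $ d / 2) / real S * \<zeta> (d, s))" for d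
          by simp
        moreover have "dot target ?c = ?L z q"
          unfolding dot_def sum_coords by (auto simp: target_def coords_def intro!: sum.cong)
        ultimately show "?G (\<zeta>, ?L z, h) = ?D ?c"
          by (simp only: prod.case)
      qed
      also have "\<dots> = (\<integral>\<^sup>+z. ?D z \<partial>(\<Pi>\<^sub>M i\<in>coords. std_normal))"
        unfolding coords_def
        by (rule nn_integral_PiM_std_normal_Plus[symmetric]) (use D in \<open>simp_all add: coords_def\<close>)
      finally show "(\<integral>\<^sup>+\<phi>. \<integral>\<^sup>+\<zeta>. ?G (\<zeta>, \<phi>, h) \<partial>?NJ \<partial>distr ?NN ?BP ?L)
          = (\<integral>\<^sup>+z. ?D z \<partial>(\<Pi>\<^sub>M i\<in>coords. std_normal))" .
    qed
    finally show ?thesis .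
  qed
  finally show ?thesis .
qed

end

section \<open>Conditional tail probabilities given the averaged outputs\<close>

lemma borel_measurable_nn_integral_std_normal:
  assumes "(\<lambda>p. f (fst p) (snd p)) \<in> borel_measurable (L \<Otimes>\<^sub>M borel)"
  shows "(\<lambda>z. \<integral>\<^sup>+t. f z t \<partial>std_normal) \<in> borel_measurable L"
proof (rule std_normal.borel_measurable_nn_integral)
  have sets: "sets (L \<Otimes>\<^sub>M std_normal) = sets (L \<Otimes>\<^sub>M borel)"
    by (intro sets_pair_measure_cong) simp_all
  show "(\<lambda>(z, t). f z t) \<in> borel_measurable (L \<Otimes>\<^sub>M std_normal)"
    unfolding measurable_cong_sets[OF sets refl] split_beta by (rule assms)
qed

context gaussian_data
begin

text \<open>The integrand of the right-hand side depends on the log-variances and the outputs only, so it has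
  the form required by \<open>nn_integral_data\<close> as well; the two frozen integrals agree by
  \<open>gaussian_regression\<close>.\<close>

lemma nn_integral_data_regression:
  assumes H: "(\<lambda>(h, y, f). H h y f) \<in> borel_measurable (borel \<Otimes>\<^sub>M borel \<Otimes>\<^sub>M borel)"
  shows "(\<integral>\<^sup>+\<omega>. H (hD \<omega>) (yE \<omega>) (F \<omega> q) \<partial>M) =
    (\<integral>\<^sup>+\<omega>. \<integral>\<^sup>+t. H (hD \<omega>) (yE \<omega>) (regression_mean k x S q (hD \<omega>) (yE \<omega>)
        + sqrt (regression_var k x S q (hD \<omega>)) * t) \<partial>std_normal \<partial>M)"
proof -
  let ?c = "\<lambda>h y t. regression_mean k x S q h y + sqrt (regression_var k x S q h) * t"
  have "(\<lambda>p. (fst (fst p), snd (fst p), ?c (fst (fst p)) (snd (fst p)) (snd p)))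
      \<in> (borel \<Otimes>\<^sub>M borel) \<Otimes>\<^sub>M borel \<rightarrow>\<^sub>M borel \<Otimes>\<^sub>M borel \<Otimes>\<^sub>M borel"
    by measurable
  from measurable_compose[OF this H]
  have K: "(\<lambda>p. \<integral>\<^sup>+t. H (fst p) (snd p) (?c (fst p) (snd p) t) \<partial>std_normal) \<in> borel_measurable (borel \<Otimes>\<^sub>M borel)"
    by (intro borel_measurable_nn_integral_std_normal) (simp add: split_beta)
  have H_h: "(\<lambda>(y, f). H h y f) \<in> borel_measurable (borel \<Otimes>\<^sub>M borel)" for h
    using measurable_compose[OF measurable_Pair1'[of h borel "borel \<Otimes>\<^sub>M borel"] H] by simp
  have K': "(\<lambda>(h, y, f :: real). \<integral>\<^sup>+t. H h y (?c h y t) \<partial>std_normal)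
      \<in> borel_measurable (borel \<Otimes>\<^sub>M borel \<Otimes>\<^sub>M borel)"
  proof -
    have "(\<lambda>(h, y, f :: real). (h, y)) \<in> borel \<Otimes>\<^sub>M borel \<Otimes>\<^sub>M borel \<rightarrow>\<^sub>M
        (borel :: (real ^ 'n) measure) \<Otimes>\<^sub>M (borel :: (real ^ 'n) measure)"
      by measurable
    from measurable_compose[OF this K] show ?thesis
      by (simp add: split_beta)
  qed
  show ?thesis
    by (simp only: nn_integral_data[OF H] nn_integral_data[OF K'] gaussian_regression[OF H_h])
qed

context
  fixes \<kappa> assumes \<kappa>: "is_cond_law M yE hD \<kappa>"
begin

lemma cond_law_space: "\<kappa> y \<in> space (prob_algebra borel)"
  using \<kappa> measurable_space[of \<kappa> borel "prob_algebra borel" y] by (simp add: is_cond_law_def)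

lemma tail_delta_measurable:
  assumes \<gamma>[measurable]: "\<gamma> \<in> borel_measurable borel"
  shows "(\<lambda>y. tail_delta k x S \<kappa> (\<gamma> y) q y) \<in> borel_measurable borel"
proof -
  have \<kappa>_sub: "\<kappa> \<in> borel \<rightarrow>\<^sub>M subprob_algebra borel"
    using \<kappa> by (intro measurable_prob_algebraD) (simp add: is_cond_law_def)
  let ?I = "\<lambda>(y, h). \<integral>\<^sup>+t. (if \<gamma> y \<le> regression_mean k x S q h y + sqrt (regression_var k x S q h) * t
      then 1 else 0) \<partial>std_normal"
  have "?I \<in> borel_measurable (borel \<Otimes>\<^sub>M borel)"
    unfolding split_beta by (intro borel_measurable_nn_integral_std_normal) measurable
  then have "(\<lambda>y. \<integral>\<^sup>+h. ?I (y, h) \<partial>\<kappa> y) \<in> borel_measurable borel"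
    using nn_integral_measurable_subprob_algebra2[OF _ \<kappa>_sub, of "\<lambda>y h. ?I (y, h)"] by simp
  also have "(\<lambda>y. \<integral>\<^sup>+h. ?I (y, h) \<partial>\<kappa> y) = (\<lambda>y. ennreal (tail_delta k x S \<kappa> (\<gamma> y) q y))"
  proof -
    have "(if c \<le> v then 1 else 0) = (indicator {c..} v :: ennreal)" for c v :: real
      by (simp add: indicator_def)
    then show ?thesis
      by (simp only: nn_tail_delta[where \<kappa> = \<kappa>, OF cond_law_space] prod.case)
  qed
  finally have "(\<lambda>y. enn2real (ennreal (tail_delta k x S \<kappa> (\<gamma> y) q y))) \<in> borel_measurable borel"
    by measurable
  moreover have "0 \<le> tail_delta k x S \<kappa> (\<gamma> y) q y" for y
    by (simp add: tail_delta_eq_mixture[where \<kappa> = \<kappa>, OF cond_law_space])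
  ultimately show ?thesis by simp
qed

text \<open>Integrated over an event determined by the outputs, the indicator of the tail event becomes a normal
  tail by \<open>nn_integral_data_regression\<close>, and the log-variances in it are then averaged over their
  conditional law by \<open>nn_integral_cond_law\<close>.\<close>

lemma cond_prob_tail:
  assumes \<gamma>[measurable]: "\<gamma> \<in> borel_measurable borel"
  shows "AE \<omega> in M. cond_prob_given M yE {\<omega> \<in> space M. \<gamma> (yE \<omega>) \<le> F \<omega> q} \<omega> =
    tail_delta k x S \<kappa> (\<gamma> (yE \<omega>)) q (yE \<omega>)"
proof -
  interpret C: finite_measure_subalgebra M "vimage_algebra (space M) yE borel"
    by (rule finite_measure_subalgebra_vimage[OF prob_space_axioms yE_measurable])
  note yE_measurable[measurable] F_target_measurable[measurable] hD_measurable[measurable]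
  let ?c = "\<lambda>h y t. regression_mean k x S q h y + sqrt (regression_var k x S q h) * t"
  let ?E = "{\<omega> \<in> space M. \<gamma> (yE \<omega>) \<le> F \<omega> q}"
  let ?T = "\<lambda>y. tail_delta k x S \<kappa> (\<gamma> y) q y"
  have T[measurable]: "?T \<in> borel_measurable borel"
    by (rule tail_delta_measurable) measurable
  have T_bounds: "0 \<le> ?T y" "?T y \<le> 1" for y
  proof -
    interpret R: real_distribution "mixture (\<kappa> y) y"
      by (rule real_distribution_mixture) (rule cond_law_space)
    show "0 \<le> ?T y" "?T y \<le> 1"
      by (simp_all add: tail_delta_eq_mixture[where \<kappa> = \<kappa>, OF cond_law_space])
  qed
  have T_int: "integrable M (\<lambda>\<omega>. ?T (yE \<omega>))"
    using T_bounds by (intro integrable_const_bound[where B = 1]) auto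
  have sets_F: "sets (vimage_algebra (space M) yE borel) = {yE -` B \<inter> space M | B. B \<in> sets borel}"
    by (rule sets_vimage_algebra2) simp
  have eq: "(\<integral>\<omega>\<in>A. indicator ?E \<omega> \<partial>M) = (\<integral>\<omega>\<in>A. ?T (yE \<omega>) \<partial>M)"
    if A_F: "A \<in> sets (vimage_algebra (space M) yE borel)" for A
  proof -
    obtain B where B[measurable]: "B \<in> sets borel" and A: "A = yE -` B \<inter> space M"
      using A_F unfolding sets_F by blast
    let ?W = "\<lambda>y f. if y \<in> B \<and> \<gamma> y \<le> f then 1 else (0 :: ennreal)"
    have "(\<integral>\<omega>\<in>A. indicator ?E \<omega> \<partial>M) = (\<integral>\<omega>. (if yE \<omega> \<in> B \<and> \<gamma> (yE \<omega>) \<le> F \<omega> q then 1 else 0 :: real) \<partial>M)"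
      unfolding set_lebesgue_integral_def
      by (intro Bochner_Integration.integral_cong) (simp_all add: A indicator_def)
    also have "\<dots> = enn2real (\<integral>\<^sup>+\<omega>. ?W (yE \<omega>) (F \<omega> q) \<partial>M)"
      by (subst integral_eq_nn_integral) (auto intro!: arg_cong[where f = enn2real] nn_integral_cong)
    also have "(\<integral>\<^sup>+\<omega>. ?W (yE \<omega>) (F \<omega> q) \<partial>M)
        = (\<integral>\<^sup>+\<omega>. \<integral>\<^sup>+t. ?W (yE \<omega>) (?c (hD \<omega>) (yE \<omega>) t) \<partial>std_normal \<partial>M)"
      by (rule nn_integral_data_regression[where H = "\<lambda>h y f. ?W y f"]) measurable
    also have "\<dots> = (\<integral>\<^sup>+\<omega>. \<integral>\<^sup>+h. \<integral>\<^sup>+t. ?W (yE \<omega>) (?c h (yE \<omega>) t)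
        \<partial>std_normal \<partial>\<kappa> (yE \<omega>) \<partial>M)"
    proof -
      have "(\<lambda>p. \<integral>\<^sup>+t. ?W (fst p) (?c (snd p) (fst p) t) \<partial>std_normal)
          \<in> borel_measurable (borel \<Otimes>\<^sub>M borel)"
        by (intro borel_measurable_nn_integral_std_normal) measurable
      from nn_integral_cond_law[OF prob_space_axioms \<kappa> yE_measurable hD_measurable this]
      show ?thesis by (simp only: fst_conv snd_conv)
    qed
    also have "\<dots> = (\<integral>\<^sup>+\<omega>. indicator B (yE \<omega>) * ennreal (?T (yE \<omega>)) \<partial>M)"
    proof (rule nn_integral_cong)
      fix \<omega>
      have W: "?W y v = indicator B y * indicator {\<gamma> y..} v" for y v
        by (simp add: indicator_def)
      show "(\<integral>\<^sup>+h. \<integral>\<^sup>+t. ?W (yE \<omega>) (?c h (yE \<omega>) t)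
          \<partial>std_normal \<partial>\<kappa> (yE \<omega>)) = indicator B (yE \<omega>) * ennreal (?T (yE \<omega>))"
        unfolding W nn_tail_delta[where \<kappa> = \<kappa>, OF cond_law_space]
        by (cases "yE \<omega> \<in> B") simp_all
    qed
    also have "enn2real \<dots> = (\<integral>\<omega>. indicator B (yE \<omega>) * ?T (yE \<omega>) \<partial>M)"
      using T_bounds by (subst integral_eq_nn_integral) (auto simp: ennreal_mult ennreal_indicator)
    also have "\<dots> = (\<integral>\<omega>\<in>A. ?T (yE \<omega>) \<partial>M)"
      unfolding set_lebesgue_integral_def
      by (intro Bochner_Integration.integral_cong) (auto simp: A indicator_def)
    finally show ?thesis .
  qed
  show ?thesis
    unfolding cond_prob_given_def
  proof (rule C.real_cond_exp_charact[OF eq _ T_int])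
    have "?E \<in> sets M" by measurable
    then show "integrable M (indicator ?E :: _ \<Rightarrow> real)"
      by (intro integrable_real_indicator) (simp_all add: emeasure_eq_measure)
    show "(\<lambda>\<omega>. ?T (yE \<omega>)) \<in> borel_measurable (vimage_algebra (space M) yE borel)"
      by (rule measurable_compose[OF measurable_vimage_algebra1 T]) simp
  qed
qed

end

end

context gaussian_data
begin

context
  fixes \<kappa> and p :: real
  assumes \<kappa>: "is_cond_law M yE hD \<kappa>" and p: "0 < p" "p < 1"
begin

lemma tail_delta_quantile: "tail_delta k x S \<kappa> (THE \<gamma>. tail_delta k x S \<kappa> \<gamma> q y = p) q y = p"
  by (rule theI') (rule ex1_tail_delta_eq[where \<kappa> = \<kappa>, OF cond_law_space[OF \<kappa>] p])

text \<open>As \<open>tail_delta\<close> is strictly decreasing in the cutoff, the sublevel sets of the quantile are sublevel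
  sets of \<open>tail_delta\<close> at a fixed cutoff.\<close>

lemma borel_measurable_tail_quantile:
  "(\<lambda>y. THE \<gamma>. tail_delta k x S \<kappa> \<gamma> q y = p) \<in> borel_measurable borel"
  unfolding borel_measurable_iff_le
proof
  fix c
  let ?q = "\<lambda>y. THE \<gamma>. tail_delta k x S \<kappa> \<gamma> q y = p"
  have "?q y \<le> c \<longleftrightarrow> tail_delta k x S \<kappa> c q y \<le> p" for y
    using tail_delta_strict_antimono[where \<kappa> = \<kappa>, OF cond_law_space[OF \<kappa>], of "?q y" c y]
      tail_delta_strict_antimono[where \<kappa> = \<kappa>, OF cond_law_space[OF \<kappa>], of c "?q y" y]
      tail_delta_quantile[of y]
    by (cases "?q y" c rule: linorder_cases) auto
  moreover have "(\<lambda>y. tail_delta k x S \<kappa> c q y) \<in> borel_measurable borel"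
    by (rule tail_delta_measurable[OF \<kappa>]) simp
  ultimately show "{y \<in> space borel. ?q y \<le> c} \<in> sets borel"
    by simp
qed

lemma cond_prob_tail_quantile:
  "AE \<omega> in M. cond_prob_given M yE
    {\<omega> \<in> space M. (THE \<gamma>. tail_delta k x S \<kappa> \<gamma> q (yE \<omega>) = p) \<le> F \<omega> q} \<omega> = p"
  using cond_prob_tail[OF \<kappa> borel_measurable_tail_quantile] by (simp add: tail_delta_quantile)

end

end

section \<open>The chance constraint\<close>

theorem theorem4:
  fixes M :: "'w measure"
    and X :: "(real ^ 2) set"
    and f g h :: "'w \<Rightarrow> real ^ 2 \<Rightarrow> real"
    and k l :: "real ^ 2 \<Rightarrow> real ^ 2 \<Rightarrow> real"
    and x :: "'n::finite \<Rightarrow> real ^ 2"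
    and S :: nat
    and w y :: "'w \<Rightarrow> 'n \<Rightarrow> nat \<Rightarrow> real"
    and yE hD :: "'w \<Rightarrow> real ^ 'n"
    and \<kappa> :: "real ^ 'n \<Rightarrow> (real ^ 'n) measure"
    and \<tau> rbar \<delta>s :: real
    and r :: "nat \<Rightarrow> real ^ 2"
    and v :: "nat \<Rightarrow> real"
    and t :: nat
    and \<xi> :: "real ^ 2"
    and uhat \<eta> :: real
    and \<gamma>u \<gamma>l uu ul u :: "real ^ 'n \<Rightarrow> real"
    and \<xi>_next :: "'w \<Rightarrow> real ^ 2"
  assumes M: "prob_space M"
    (* parameters and reference *)
    and params: "0 < \<tau>" "0 \<le> rbar" "0 < \<delta>s" "\<delta>s < 1"
    and reference: "\<And>s. r (Suc s) = r s + \<tau> *\<^sub>R vector [r s $ 2, v s]"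
    (* Gaussian process model *)
    and g_pos: "\<And>\<omega> p. \<omega> \<in> space M \<Longrightarrow> p \<in> X \<Longrightarrow> 0 < g \<omega> p"
    and h: "h = (\<lambda>\<omega> p. ln ((g \<omega> p)\<^sup>2))"
    and k: "strictly_pos_def_kernel X k"
    and l: "strictly_pos_def_kernel X l"
    and f_gp: "gaussian_process M X f k"
    and h_gp: "gaussian_process M X h l"
    and fh_indep: "prob_space.indep_var M
          (\<Pi>\<^sub>M p\<in>X. borel) (\<lambda>\<omega>. restrict (f \<omega>) X)
          (\<Pi>\<^sub>M p\<in>X. borel) (\<lambda>\<omega>. restrict (h \<omega>) X)"
    (* data model *)
    and x: "inj x" "range x \<subseteq> X"
    and S: "1 \<le> S"
    and noise_normal: "\<And>d s. s \<in> {1..S} \<Longrightarrow>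
          distributed M lborel (\<lambda>\<omega>. w \<omega> d s / g \<omega> (x d)) std_normal_density"
    and noise_iid: "prob_space.indep_vars M (\<lambda>_. borel)
          (\<lambda>(d, s) \<omega>. w \<omega> d s / g \<omega> (x d)) (UNIV \<times> {1..S})"
    and noise_indep: "indep_elements M
          (\<Pi>\<^sub>M ds\<in>UNIV \<times> {1..S}. borel)
          (\<lambda>\<omega>. \<lambda>(d, s)\<in>UNIV \<times> {1..S}. w \<omega> d s / g \<omega> (x d))
          ((\<Pi>\<^sub>M p\<in>X. borel) \<Otimes>\<^sub>M (\<Pi>\<^sub>M p\<in>X. borel))
          (\<lambda>\<omega>. (restrict (f \<omega>) X, restrict (h \<omega>) X))"
    and y: "y = (\<lambda>\<omega> d s. f \<omega> (x d) + w \<omega> d s)"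
    and yE: "yE = (\<lambda>\<omega>. \<chi> d. 1 / real S * (\<Sum>s = 1..S. y \<omega> d s))"
    and hD: "hD = (\<lambda>\<omega>. \<chi> d. h \<omega> (x d))"
    and \<kappa>: "is_cond_law M yE hD \<kappa>"
    (* control law; its argument is the value D of the averaged outputs yE *)
    and \<xi>: "\<xi> \<in> X"
    and uhat: "uhat = v t - (\<xi> $ 1 - r t $ 1) / \<tau>"
    and \<eta>: "\<eta> = - uhat + (r (Suc t) $ 2 - \<xi> $ 2) / \<tau>"
    and \<gamma>u: "\<gamma>u = (\<lambda>D. THE \<gamma>. tail_delta k x S \<kappa> \<gamma> \<xi> D = \<delta>s / 2)"
    and \<gamma>l: "\<gamma>l = (\<lambda>D. THE \<gamma>. tail_delta k x S \<kappa> \<gamma> \<xi> D = 1 - \<delta>s / 2)"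
    and uu: "uu = (\<lambda>D. - \<gamma>u D + rbar / \<tau> + \<eta>)"
    and ul: "ul = (\<lambda>D. - \<gamma>l D - rbar / \<tau> + \<eta>)"
    and u: "u = (\<lambda>D. if uu D < 0 then uu D else if ul D > 0 then ul D else 0)"
    and \<xi>_next: "\<xi>_next = (\<lambda>\<omega>. \<xi> + \<tau> *\<^sub>R vector [\<xi> $ 2, f \<omega> \<xi> + uhat + u (yE \<omega>)])"
  shows "(\<forall>D. (\<exists>!\<gamma>. tail_delta k x S \<kappa> \<gamma> \<xi> D = \<delta>s / 2) \<and>
              (\<exists>!\<gamma>. tail_delta k x S \<kappa> \<gamma> \<xi> D = 1 - \<delta>s / 2)) \<and>
         (AE \<omega> in M. ul (yE \<omega>) \<le> uu (yE \<omega>) \<longrightarrow>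
            cond_prob_given M yE {\<omega>' \<in> space M. \<bar>\<xi>_next \<omega>' $ 2 - r (Suc t) $ 2\<bar> \<le> rbar} \<omega>
              \<ge> 1 - \<delta>s)"
proof -
  interpret prob_space M by (rule M)
  let ?P = "insert \<xi> (range x)" and ?J = "UNIV \<times> {1..S} :: ('n \<times> nat) set"
  let ?BX = "\<Pi>\<^sub>M p\<in>X. borel :: real measure" and ?BP = "\<Pi>\<^sub>M p\<in>?P. borel :: real measure"
  let ?BJ = "\<Pi>\<^sub>M ds\<in>?J. borel :: real measure"
  define \<zeta> where "\<zeta> \<omega> = (\<lambda>(d, s). w \<omega> d s / g \<omega> (x d))" for \<omega>
  have P: "finite ?P" "?P \<subseteq> X"
    using x \<xi> by auto
  have x_X: "x d \<in> X" for d
    using x(2) by auto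
  obtain \<psi> where \<psi>: "\<And>a b. a \<in> ?P \<Longrightarrow> b \<in> ?P \<Longrightarrow> k a b = (\<Sum>m<card ?P. \<psi> a m * \<psi> b m)"
    and f_law: "distr M ?BP (\<lambda>\<omega>. \<lambda>a\<in>?P. f \<omega> a) =
     distr (\<Pi>\<^sub>M m\<in>{..<card ?P}. std_normal) ?BP (\<lambda>z. \<lambda>a\<in>?P. \<Sum>m<card ?P. \<psi> a m * z m)"
    using gaussian_process_features[OF f_gp P] by blast
  have kernel_pos: "0 < k \<xi> \<xi>"
  proof -
    have "pos_def_matrix 1 (\<lambda>i j. k \<xi> \<xi>)"
      using k \<xi> unfolding strictly_pos_def_kernel_def
      by (elim allE[of _ 1] allE[of _ "\<lambda>_. \<xi>"]) (auto simp: inj_on_def)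
    then show ?thesis
      by (auto simp: pos_def_matrix_def dest: spec[of _ "\<lambda>_. 1 :: real"])
  qed
  let ?rP = "\<lambda>\<phi>. restrict \<phi> ?P :: real ^ 2 \<Rightarrow> real" and ?ev = "\<lambda>\<phi>. \<chi> d. \<phi> (x d) :: real ^ 'n"
  have rP: "?rP \<in> ?BX \<rightarrow>\<^sub>M ?BP"
    using P by (intro measurable_restrict_subset)
  have ev: "?ev \<in> ?BX \<rightarrow>\<^sub>M borel"
    using P by (intro borel_measurable_vec_lambda measurable_component_singleton) auto
  have rP_X: "?rP (restrict (f \<omega>) X) = restrict (f \<omega>) ?P" for \<omega>
    unfolding restrict_restrict Int_absorb1[OF P(2)] ..
  have ev_X: "?ev (restrict (h \<omega>) X) = hD \<omega>" for \<omega>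
    using x_X by (simp add: hD)
  have fh: "indep_elements M ?BP (\<lambda>\<omega>. restrict (f \<omega>) ?P) borel hD"
    using indep_elements_compose[OF M indep_elements_of_indep_var[OF M fh_indep] rP ev]
    by (simp only: rP_X ev_X)
  have \<zeta>fh: "indep_elements M ?BJ (\<lambda>\<omega>. restrict (\<zeta> \<omega>) ?J) (?BP \<Otimes>\<^sub>M borel) (\<lambda>\<omega>. (restrict (f \<omega>) ?P, hD \<omega>))"
  proof -
    have "(\<lambda>(\<phi>, \<eta>). (?rP \<phi>, ?ev \<eta>)) \<in> ?BX \<Otimes>\<^sub>M ?BX \<rightarrow>\<^sub>M ?BP \<Otimes>\<^sub>M borel"
      unfolding split_beta
      by (intro measurable_Pair measurable_compose[OF measurable_fst rP] measurable_compose[OF measurable_snd ev])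
    from indep_elements_compose[OF M noise_indep measurable_ident this]
    show ?thesis
      by (simp only: id_apply prod.case rP_X ev_X \<zeta>_def)
  qed
  have noise_law: "distr M ?BJ (\<lambda>\<omega>. restrict (\<zeta> \<omega>) ?J) = (\<Pi>\<^sub>M ds\<in>?J. std_normal)"
  proof -
    let ?Z = "\<lambda>(d, s) \<omega>. w \<omega> d s / g \<omega> (x d)"
    have law: "distr M borel (?Z i) = std_normal" and rv: "?Z i \<in> borel_measurable M" if i_J: "i \<in> ?J" for i
    proof -
      obtain d s where i: "i = (d, s)" "s \<in> {1..S}"
        using i_J by auto
      have "distr M borel (?Z i) = distr M lborel (?Z i)"
        by (rule distr_cong) simp_all
      then show "distr M borel (?Z i) = std_normal"
        using distributed_distr_eq_density[OF noise_normal[OF i(2), of d]] by (simp add: i)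
      show "?Z i \<in> borel_measurable M"
        using distributed_measurable[OF noise_normal[OF i(2), of d]] by (simp add: i)
    qed
    have "?J \<noteq> {}" using S by simp
    then have "distr M ?BJ (\<lambda>\<omega>. \<lambda>i\<in>?J. ?Z i \<omega>) = (\<Pi>\<^sub>M i\<in>?J. distr M borel (?Z i))"
      using indep_vars_iff_distr_eq_PiM'[of ?J ?Z "\<lambda>_. borel"] rv noise_iid by blast
    also have "\<dots> = (\<Pi>\<^sub>M ds\<in>?J. std_normal)"
      by (rule PiM_cong) (simp_all add: law)
    also have "(\<lambda>\<omega>. \<lambda>i\<in>?J. ?Z i \<omega>) = (\<lambda>\<omega>. restrict (\<zeta> \<omega>) ?J)"
      by (auto simp: \<zeta>_def restrict_def)
    finally show ?thesis .
  qed
  \<comment> \<open>Since h = ln g^2 with g positive, exp (h / 2) is g, so the noise w is exp (h / 2) times \<zeta>.\<close>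
  have yE_eq: "yE \<omega> = (\<chi> d. f \<omega> (x d) + (\<Sum>s = 1..S. exp (hD \<omega> $ d / 2) / real S * \<zeta> \<omega> (d, s)))"
    if "\<omega> \<in> space M" for \<omega>
  proof -
    have "0 < g \<omega> (x d)" for d
      using g_pos that x_X by simp
    then have exp_h: "exp (hD \<omega> $ d / 2) = g \<omega> (x d)" and g_nz: "g \<omega> (x d) \<noteq> 0" for d
      by (simp_all add: hD h ln_realpow less_imp_neq[symmetric])
    have "1 / real S * (\<Sum>s = 1..S. y \<omega> d s) = f \<omega> (x d) + (\<Sum>s = 1..S. 1 / real S * w \<omega> d s)" for d
      using S by (simp add: y sum.distrib distrib_left sum_distrib_left)
    moreover have "1 / real S * w \<omega> d s = exp (hD \<omega> $ d / 2) / real S * \<zeta> \<omega> (d, s)" for d s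
      using g_nz by (simp add: exp_h \<zeta>_def)
    ultimately show ?thesis by (simp only: yE)
  qed
  interpret gaussian_data k x S \<xi> "card ?P" \<psi> M f hD yE \<zeta>
  proof
    show "k a b = (\<Sum>m<card ?P. \<psi> a m * \<psi> b m)" if "a \<in> ?P" "b \<in> ?P" for a b
      using that by (rule \<psi>)
    show "0 < k \<xi> \<xi>" "1 \<le> S" by (rule kernel_pos, rule S)
    show "(\<lambda>\<omega>. \<lambda>a\<in>?P. f \<omega> a) \<in> M \<rightarrow>\<^sub>M ?BP" "hD \<in> borel_measurable M"
      using fh by (simp_all add: indep_elements_def)
    show "(\<lambda>\<omega>. restrict (\<zeta> \<omega>) ?J) \<in> M \<rightarrow>\<^sub>M ?BJ"
      using \<zeta>fh by (simp add: indep_elements_def)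
    show "distr M (?BJ \<Otimes>\<^sub>M (?BP \<Otimes>\<^sub>M borel)) (\<lambda>\<omega>. (restrict (\<zeta> \<omega>) ?J, (\<lambda>a\<in>?P. f \<omega> a), hD \<omega>)) =
      (\<Pi>\<^sub>M ds\<in>?J. std_normal) \<Otimes>\<^sub>M (distr (\<Pi>\<^sub>M m\<in>{..<card ?P}. std_normal) ?BP
        (\<lambda>z. \<lambda>a\<in>?P. \<Sum>m<card ?P. \<psi> a m * z m) \<Otimes>\<^sub>M distr M borel hD)"
      by (simp only: distr_pair_indep_elements[OF M \<zeta>fh] distr_pair_indep_elements[OF M fh] noise_law f_law)
  qed (rule yE_eq)
  have \<delta>s: "0 < \<delta>s / 2" "\<delta>s / 2 < 1" "0 < 1 - \<delta>s / 2" "1 - \<delta>s / 2 < 1"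
    using params by simp_all
  have ex1: "\<forall>D. (\<exists>!\<gamma>. tail_delta k x S \<kappa> \<gamma> \<xi> D = \<delta>s / 2) \<and> (\<exists>!\<gamma>. tail_delta k x S \<kappa> \<gamma> \<xi> D = 1 - \<delta>s / 2)"
    using ex1_tail_delta_eq[where \<kappa> = \<kappa>, OF cond_law_space[OF \<kappa>]] \<delta>s by blast
  have [measurable]: "\<gamma>u \<in> borel_measurable borel" "\<gamma>l \<in> borel_measurable borel"
    unfolding \<gamma>u \<gamma>l by (rule borel_measurable_tail_quantile[OF \<kappa>] \<delta>s)+
  have [measurable]: "uu \<in> borel_measurable borel" "ul \<in> borel_measurable borel"
    unfolding uu ul by measurable
  have [measurable]: "u \<in> borel_measurable borel"
    unfolding u by measurable
  note yE_measurable[measurable] F_target_measurable[measurable]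
  let ?E = "{\<omega> \<in> space M. \<bar>\<xi>_next \<omega> $ 2 - r (Suc t) $ 2\<bar> \<le> rbar}"
  have deviation: "\<bar>\<xi>_next \<omega> $ 2 - r (Suc t) $ 2\<bar> \<le> rbar \<longleftrightarrow> \<bar>f \<omega> \<xi> + u (yE \<omega>) - \<eta>\<bar> \<le> rbar / \<tau>" for \<omega>
  proof -
    have "\<xi>_next \<omega> $ 2 - r (Suc t) $ 2 = \<tau> * (f \<omega> \<xi> + u (yE \<omega>) - \<eta>)"
      using params(1) by (simp add: \<xi>_next \<eta> field_simps)
    then have "\<bar>\<xi>_next \<omega> $ 2 - r (Suc t) $ 2\<bar> = \<bar>f \<omega> \<xi> + u (yE \<omega>) - \<eta>\<bar> * \<tau>"
      using params(1) by (simp only: abs_mult abs_of_pos mult.commute)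
    then show ?thesis
      by (simp only: pos_le_divide_eq[OF params(1)])
  qed
  have "AE \<omega> in M. yE \<omega> \<in> {D. ul D \<le> uu D} \<longrightarrow>
      cond_prob_given M yE {\<omega> \<in> space M. \<gamma>l (yE \<omega>) \<le> f \<omega> \<xi>} \<omega>
        - cond_prob_given M yE {\<omega> \<in> space M. \<gamma>u (yE \<omega>) \<le> f \<omega> \<xi>} \<omega>
      \<le> cond_prob_given M yE ?E \<omega>"
  proof (rule cond_prob_given_ge_diff[OF M yE_measurable])
    show "?E \<in> sets M"
      unfolding deviation by measurable
    fix \<omega>
    assume \<omega>: "\<omega> \<in> space M" "yE \<omega> \<in> {D. ul D \<le> uu D}"
      "\<omega> \<in> {\<omega> \<in> space M. \<gamma>l (yE \<omega>) \<le> f \<omega> \<xi>}" "\<omega> \<notin> {\<omega> \<in> space M. \<gamma>u (yE \<omega>) \<le> f \<omega> \<xi>}"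
    then have "ul (yE \<omega>) \<le> u (yE \<omega>)" "u (yE \<omega>) \<le> uu (yE \<omega>)"
      by (auto simp: u)
    then have "\<bar>f \<omega> \<xi> + u (yE \<omega>) - \<eta>\<bar> \<le> rbar / \<tau>"
      using \<omega> unfolding uu ul by (auto simp: abs_le_iff)
    then show "\<omega> \<in> ?E"
      using \<omega>(1) deviation by simp
  qed measurable
  moreover have "AE \<omega> in M. cond_prob_given M yE {\<omega> \<in> space M. \<gamma>l (yE \<omega>) \<le> f \<omega> \<xi>} \<omega> = 1 - \<delta>s / 2"
    unfolding \<gamma>l by (rule cond_prob_tail_quantile[OF \<kappa> \<delta>s(3,4)])
  moreover have "AE \<omega> in M. cond_prob_given M yE {\<omega> \<in> space M. \<gamma>u (yE \<omega>) \<le> f \<omega> \<xi>} \<omega> = \<delta>s / 2"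
    unfolding \<gamma>u by (rule cond_prob_tail_quantile[OF \<kappa> \<delta>s(1,2)])
  ultimately have "AE \<omega> in M. ul (yE \<omega>) \<le> uu (yE \<omega>) \<longrightarrow> cond_prob_given M yE ?E \<omega> \<ge> 1 - \<delta>s"
    by eventually_elim auto
  with ex1 show ?thesis by blast
qed

end
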